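(* The forgetful functor $V\colon \mathsf{LMSet}\to \mathsf{Mon}$, $(M,X,\phi)\mapsto M$, is a cartesian monoidal opfibration.
   Context: $\mathsf{Mon}$ is the category of monoids. $\mathsf{LMSet}$ is the category of monoid left actions: objects are triples $(M,X,\phi)$ with $M$ a monoid, $X$ a set and $\phi\colon M\times X\to X$ a left action of $M$ on $X$; an arrow $(M,X,\phi)\to(N,Y,\psi)$ is a pair $(f,f_0)$ with $f\colon M\to N$ a monoid homomorphism and $f_0\colon X\to Y$ a function such that $f_0\circ\phi=\psi\circ(f\times f_0)$. $V$ sends $(f,f_0)$ to $f$. A functor $P\colon\mathsf X\to\mathsf B$ is a cartesian monoidal opfibration when it is a (Grothendieck) opfibration, $\mathsf X$ and $\mathsf B$ have finite products, $P$ is a strict monoidal functor with respect to the cartesian monoidal structures (it strictly preserves finite products), and the product of $P$-cocartesian arrows is $P$-cocartesian. *)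

theory Defs
  imports "HOL-Algebra.Group" "HOL-Library.FuncSet"
begin

section \<open>Categories and functors\<close>

record ('o, 'm) cat =
  Obj :: "'o set"
  Arr :: "'m set"
  Dom :: "'m \<Rightarrow> 'o"
  Cod :: "'m \<Rightarrow> 'o"
  Id :: "'o \<Rightarrow> 'm"
  Comp :: "'m \<Rightarrow> 'm \<Rightarrow> 'm"  (* Comp C g f is g after f *)

definition Hom :: "('o, 'm) cat \<Rightarrow> 'o \<Rightarrow> 'o \<Rightarrow> 'm set" where
  "Hom C a b = {f \<in> Arr C. Dom C f = a \<and> Cod C f = b}"

locale category =
  fixes C :: "('o, 'm) cat"
  assumes Dom_Obj: "f \<in> Arr C \<Longrightarrow> Dom C f \<in> Obj C"
    and Cod_Obj: "f \<in> Arr C \<Longrightarrow> Cod C f \<in> Obj C"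
    and Id_Hom: "a \<in> Obj C \<Longrightarrow> Id C a \<in> Hom C a a"
    and Comp_Hom: "f \<in> Hom C a b \<Longrightarrow> g \<in> Hom C b c \<Longrightarrow> Comp C g f \<in> Hom C a c"
    and Comp_Id: "f \<in> Hom C a b \<Longrightarrow> Comp C f (Id C a) = f"
    and Id_Comp: "f \<in> Hom C a b \<Longrightarrow> Comp C (Id C b) f = f"
    and Comp_assoc: "f \<in> Hom C a b \<Longrightarrow> g \<in> Hom C b c \<Longrightarrow> h \<in> Hom C c d
      \<Longrightarrow> Comp C h (Comp C g f) = Comp C (Comp C h g) f"

record ('o, 'm, 'p, 'n) fctr =
  obj_map :: "'o \<Rightarrow> 'p"
  arr_map :: "'m \<Rightarrow> 'n"

locale functor_between = X: category X + B: category B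
  for X :: "('o, 'm) cat" and B :: "('p, 'n) cat" +
  fixes P :: "('o, 'm, 'p, 'n) fctr"
  assumes obj_map_Obj: "a \<in> Obj X \<Longrightarrow> obj_map P a \<in> Obj B"
    and arr_map_Hom: "f \<in> Hom X a b \<Longrightarrow> arr_map P f \<in> Hom B (obj_map P a) (obj_map P b)"
    and arr_map_Id: "a \<in> Obj X \<Longrightarrow> arr_map P (Id X a) = Id B (obj_map P a)"
    and arr_map_Comp: "f \<in> Hom X a b \<Longrightarrow> g \<in> Hom X b c
      \<Longrightarrow> arr_map P (Comp X g f) = Comp B (arr_map P g) (arr_map P f)"


section \<open>Finite products and the cartesian monoidal structure\<close>

definition is_terminal :: "('o, 'm) cat \<Rightarrow> 'o \<Rightarrow> bool" where
  "is_terminal C t \<longleftrightarrow> t \<in> Obj C \<and> (\<forall>a\<in>Obj C. \<exists>!f. f \<in> Hom C a t)"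

definition is_product :: "('o, 'm) cat \<Rightarrow> 'o \<Rightarrow> 'o \<Rightarrow> 'o \<Rightarrow> 'm \<Rightarrow> 'm \<Rightarrow> bool" where
  "is_product C a b c p q \<longleftrightarrow> p \<in> Hom C c a \<and> q \<in> Hom C c b \<and>
     (\<forall>x\<in>Obj C. \<forall>f\<in>Hom C x a. \<forall>g\<in>Hom C x b.
        \<exists>!h. h \<in> Hom C x c \<and> Comp C p h = f \<and> Comp C q h = g)"

(* A choice of finite products: a terminal object, and for each pair of objects a product cone. *)
record ('o, 'm) products =
  terminal_ob :: 'o
  prod_ob :: "'o \<Rightarrow> 'o \<Rightarrow> 'o"
  proj1 :: "'o \<Rightarrow> 'o \<Rightarrow> 'm"
  proj2 :: "'o \<Rightarrow> 'o \<Rightarrow> 'm"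

locale cartesian_category = category C
  for C :: "('o, 'm) cat" and S :: "('o, 'm) products" +
  assumes terminal: "is_terminal C (terminal_ob S)"
    and product: "a \<in> Obj C \<Longrightarrow> b \<in> Obj C
      \<Longrightarrow> is_product C a b (prod_ob S a b) (proj1 S a b) (proj2 S a b)"

definition pairing :: "('o, 'm) cat \<Rightarrow> ('o, 'm) products \<Rightarrow> 'm \<Rightarrow> 'm \<Rightarrow> 'm" where
  "pairing C S f g = (THE h. h \<in> Hom C (Dom C f) (prod_ob S (Cod C f) (Cod C g)) \<and>
     Comp C (proj1 S (Cod C f) (Cod C g)) h = f \<and> Comp C (proj2 S (Cod C f) (Cod C g)) h = g)"

definition prod_arr :: "('o, 'm) cat \<Rightarrow> ('o, 'm) products \<Rightarrow> 'm \<Rightarrow> 'm \<Rightarrow> 'm" where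
  "prod_arr C S f g = pairing C S
     (Comp C f (proj1 S (Dom C f) (Dom C g))) (Comp C g (proj2 S (Dom C f) (Dom C g)))"

(* The canonical isomorphism from (a * b) * c to a * (b * c). *)
definition associator ::
    "('o, 'm) cat \<Rightarrow> ('o, 'm) products \<Rightarrow> 'o \<Rightarrow> 'o \<Rightarrow> 'o \<Rightarrow> 'm" where
  "associator C S a b c = pairing C S
     (Comp C (proj1 S a b) (proj1 S (prod_ob S a b) c))
     (pairing C S (Comp C (proj2 S a b) (proj1 S (prod_ob S a b) c)) (proj2 S (prod_ob S a b) c))"

definition left_unitor :: "('o, 'm) products \<Rightarrow> 'o \<Rightarrow> 'm" where
  "left_unitor S a = proj2 S (terminal_ob S) a"

definition right_unitor :: "('o, 'm) products \<Rightarrow> 'o \<Rightarrow> 'm" where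
  "right_unitor S a = proj1 S a (terminal_ob S)"

(* Strict monoidality for the cartesian structures. The clauses on projections say that product
   cones go to product cones; they also follow from the other clauses, because each projection
   is a unitor after the product of an identity with the arrow to the terminal object. *)
locale strict_cartesian_functor =
  functor_between X B P + X: cartesian_category X S + B: cartesian_category B T
  for X :: "('o, 'm) cat" and S :: "('o, 'm) products"
    and B :: "('p, 'n) cat" and T :: "('p, 'n) products"
    and P :: "('o, 'm, 'p, 'n) fctr" +
  assumes terminal_ob_map: "obj_map P (terminal_ob S) = terminal_ob T"
    and prod_ob_map: "a \<in> Obj X \<Longrightarrow> b \<in> Obj X
      \<Longrightarrow> obj_map P (prod_ob S a b) = prod_ob T (obj_map P a) (obj_map P b)"
    and proj1_map: "a \<in> Obj X \<Longrightarrow> b \<in> Obj X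
      \<Longrightarrow> arr_map P (proj1 S a b) = proj1 T (obj_map P a) (obj_map P b)"
    and proj2_map: "a \<in> Obj X \<Longrightarrow> b \<in> Obj X
      \<Longrightarrow> arr_map P (proj2 S a b) = proj2 T (obj_map P a) (obj_map P b)"
    and prod_arr_map: "f \<in> Arr X \<Longrightarrow> g \<in> Arr X
      \<Longrightarrow> arr_map P (prod_arr X S f g) = prod_arr B T (arr_map P f) (arr_map P g)"
    and associator_map: "a \<in> Obj X \<Longrightarrow> b \<in> Obj X \<Longrightarrow> c \<in> Obj X
      \<Longrightarrow> arr_map P (associator X S a b c)
        = associator B T (obj_map P a) (obj_map P b) (obj_map P c)"
    and left_unitor_map: "a \<in> Obj X
      \<Longrightarrow> arr_map P (left_unitor S a) = left_unitor T (obj_map P a)"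
    and right_unitor_map: "a \<in> Obj X
      \<Longrightarrow> arr_map P (right_unitor S a) = right_unitor T (obj_map P a)"


section \<open>Opfibrations\<close>

definition cocartesian ::
    "('o, 'm) cat \<Rightarrow> ('p, 'n) cat \<Rightarrow> ('o, 'm, 'p, 'n) fctr \<Rightarrow> 'm \<Rightarrow> bool" where
  "cocartesian X B P u \<longleftrightarrow> u \<in> Arr X \<and>
     (\<forall>c\<in>Obj X. \<forall>v\<in>Hom X (Dom X u) c. \<forall>g\<in>Hom B (obj_map P (Cod X u)) (obj_map P c).
        Comp B g (arr_map P u) = arr_map P v \<longrightarrow>
        (\<exists>!w. w \<in> Hom X (Cod X u) c \<and> arr_map P w = g \<and> Comp X w u = v))"

locale opfibration = functor_between X B P
  for X :: "('o, 'm) cat" and B :: "('p, 'n) cat" and P :: "('o, 'm, 'p, 'n) fctr" +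
  assumes cocartesian_lift: "a \<in> Obj X \<Longrightarrow> f \<in> Arr B \<Longrightarrow> Dom B f = obj_map P a
      \<Longrightarrow> \<exists>u. Dom X u = a \<and> arr_map P u = f \<and> cocartesian X B P u"

locale cartesian_monoidal_opfibration =
  opfibration X B P + strict_cartesian_functor X S B T P
  for X :: "('o, 'm) cat" and S :: "('o, 'm) products"
    and B :: "('p, 'n) cat" and T :: "('p, 'n) products"
    and P :: "('o, 'm, 'p, 'n) fctr" +
  assumes cocartesian_prod_arr: "cocartesian X B P u \<Longrightarrow> cocartesian X B P v
      \<Longrightarrow> cocartesian X B P (prod_arr X S u v)"


section \<open>Small sets\<close>

(* HOL has no type of all small sets, so smallness is relative to a family U of subsets of a
   type, with a pairing operation and a point. Any Grothendieck universe, viewed as a type with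
   U the extensions of its elements, is an instance; so is the family of all subsets of an
   arbitrary infinite type (ex_universe below). *)

definition pair_set :: "('u \<Rightarrow> 'u \<Rightarrow> 'u) \<Rightarrow> 'u set \<Rightarrow> 'u set \<Rightarrow> 'u set" where
  "pair_set pr A B = {pr a b | a b. a \<in> A \<and> b \<in> B}"

locale universe =
  fixes U :: "'u set set" and pr :: "'u \<Rightarrow> 'u \<Rightarrow> 'u" and pt :: 'u
  assumes pr_inject: "pr a b = pr c d \<longleftrightarrow> a = c \<and> b = d"
    and point_small: "{pt} \<in> U"
    and subset_small: "A \<in> U \<Longrightarrow> B \<subseteq> A \<Longrightarrow> B \<in> U"
    and pair_set_small: "A \<in> U \<Longrightarrow> B \<in> U \<Longrightarrow> pair_set pr A B \<in> U"

lemma ex_universe: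
  assumes "infinite (UNIV :: 'u set)"
  shows "\<exists>pr. universe (UNIV :: 'u set set) pr pt"
proof -
  obtain h :: "'u \<times> 'u \<Rightarrow> 'u" where "bij_betw h (UNIV \<times> UNIV) UNIV"
    using card_of_ordIso[THEN iffD2, OF card_of_Times_same_infinite[OF assms]] by blast
  then have "inj h"
    by (simp add: bij_betw_def)
  then have "universe UNIV (\<lambda>a b. h (a, b)) pt"
    by unfold_locales (auto dest: injD)
  then show ?thesis
    by blast
qed

definition pr_fst :: "('u \<Rightarrow> 'u \<Rightarrow> 'u) \<Rightarrow> 'u \<Rightarrow> 'u" where
  "pr_fst pr z = (THE a. \<exists>b. z = pr a b)"

definition pr_snd :: "('u \<Rightarrow> 'u \<Rightarrow> 'u) \<Rightarrow> 'u \<Rightarrow> 'u" where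
  "pr_snd pr z = (THE b. \<exists>a. z = pr a b)"


section \<open>The category of monoids\<close>

datatype ('o, 'f) arrow = Arrow (src: 'o) (fn: 'f) (tgt: 'o)

(* Operations and maps are required to be undefined off their domains, so that equality of
   objects and of arrows in HOL is equality of the structures they represent. *)

definition monoid_objects :: "'u set set \<Rightarrow> 'u monoid set" where
  "monoid_objects U = {M. monoid M \<and> carrier M \<in> U \<and>
     (\<forall>x y. \<not> (x \<in> carrier M \<and> y \<in> carrier M) \<longrightarrow> x \<otimes>\<^bsub>M\<^esub> y = undefined)}"

(* hom only asks for multiplicativity; preservation of the unit has to be added. *)
definition monoid_hom :: "'u monoid \<Rightarrow> 'u monoid \<Rightarrow> ('u \<Rightarrow> 'u) set" where
  "monoid_hom M N = {f \<in> hom M N. f \<in> extensional (carrier M) \<and> f \<one>\<^bsub>M\<^esub> = \<one>\<^bsub>N\<^esub>}"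

type_synonym 'u monoid_arrow = "('u monoid, 'u \<Rightarrow> 'u) arrow"

definition Mon :: "'u set set \<Rightarrow> ('u monoid, 'u monoid_arrow) cat" where
  "Mon U = \<lparr>
     Obj = monoid_objects U,
     Arr = {Arrow M f N | M f N.
       M \<in> monoid_objects U \<and> N \<in> monoid_objects U \<and> f \<in> monoid_hom M N},
     Dom = src,
     Cod = tgt,
     Id = (\<lambda>M. Arrow M (restrict id (carrier M)) M),
     Comp = (\<lambda>g f. Arrow (src f) (compose (carrier (src f)) (fn g) (fn f)) (tgt g))\<rparr>"

definition trivial_monoid :: "'u \<Rightarrow> 'u monoid" where
  "trivial_monoid pt = \<lparr>carrier = {pt},
     mult = (\<lambda>x y. if x = pt \<and> y = pt then pt else undefined), one = pt\<rparr>"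

definition prod_monoid :: "('u \<Rightarrow> 'u \<Rightarrow> 'u) \<Rightarrow> 'u monoid \<Rightarrow> 'u monoid \<Rightarrow> 'u monoid" where
  "prod_monoid pr M N = (let C = pair_set pr (carrier M) (carrier N) in
     \<lparr>carrier = C,
      mult = (\<lambda>z w. if z \<in> C \<and> w \<in> C
        then pr (pr_fst pr z \<otimes>\<^bsub>M\<^esub> pr_fst pr w) (pr_snd pr z \<otimes>\<^bsub>N\<^esub> pr_snd pr w)
        else undefined),
      one = pr \<one>\<^bsub>M\<^esub> \<one>\<^bsub>N\<^esub>\<rparr>)"

definition Mon_products ::
    "('u \<Rightarrow> 'u \<Rightarrow> 'u) \<Rightarrow> 'u \<Rightarrow> ('u monoid, 'u monoid_arrow) products" where
  "Mon_products pr pt = \<lparr>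
     terminal_ob = trivial_monoid pt,
     prod_ob = prod_monoid pr,
     proj1 = (\<lambda>M N. Arrow (prod_monoid pr M N)
       (restrict (pr_fst pr) (pair_set pr (carrier M) (carrier N))) M),
     proj2 = (\<lambda>M N. Arrow (prod_monoid pr M N)
       (restrict (pr_snd pr) (pair_set pr (carrier M) (carrier N))) N)\<rparr>"


section \<open>The category of monoid left actions\<close>

datatype 'u lmset = LMSet_obj (mon: "'u monoid") (pts: "'u set") (act: "'u \<times> 'u \<Rightarrow> 'u")

definition left_action :: "'u monoid \<Rightarrow> 'u set \<Rightarrow> ('u \<times> 'u \<Rightarrow> 'u) \<Rightarrow> bool" where
  "left_action M X \<phi> \<longleftrightarrow> \<phi> \<in> carrier M \<times> X \<rightarrow>\<^sub>E X \<and>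
     (\<forall>x\<in>X. \<phi> (\<one>\<^bsub>M\<^esub>, x) = x) \<and>
     (\<forall>m\<in>carrier M. \<forall>n\<in>carrier M. \<forall>x\<in>X. \<phi> (m \<otimes>\<^bsub>M\<^esub> n, x) = \<phi> (m, \<phi> (n, x)))"

definition lmset_objects :: "'u set set \<Rightarrow> 'u lmset set" where
  "lmset_objects U = {LMSet_obj M X \<phi> | M X \<phi>.
     M \<in> monoid_objects U \<and> X \<in> U \<and> left_action M X \<phi>}"

definition lmset_hom :: "'u lmset \<Rightarrow> 'u lmset \<Rightarrow> (('u \<Rightarrow> 'u) \<times> ('u \<Rightarrow> 'u)) set" where
  "lmset_hom A B = {(f, f0). f \<in> monoid_hom (mon A) (mon B) \<and> f0 \<in> pts A \<rightarrow>\<^sub>E pts B \<and>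
     (\<forall>m\<in>carrier (mon A). \<forall>x\<in>pts A. f0 (act A (m, x)) = act B (f m, f0 x))}"

type_synonym 'u lmset_arrow = "('u lmset, ('u \<Rightarrow> 'u) \<times> ('u \<Rightarrow> 'u)) arrow"

definition LMSet :: "'u set set \<Rightarrow> ('u lmset, 'u lmset_arrow) cat" where
  "LMSet U = \<lparr>
     Obj = lmset_objects U,
     Arr = {Arrow A h B | A h B.
       A \<in> lmset_objects U \<and> B \<in> lmset_objects U \<and> h \<in> lmset_hom A B},
     Dom = src,
     Cod = tgt,
     Id = (\<lambda>A. Arrow A (restrict id (carrier (mon A)), restrict id (pts A)) A),
     Comp = (\<lambda>g f. Arrow (src f)
       (compose (carrier (mon (src f))) (fst (fn g)) (fst (fn f)),
        compose (pts (src f)) (snd (fn g)) (snd (fn f))) (tgt g))\<rparr>"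

definition trivial_lmset :: "'u \<Rightarrow> 'u lmset" where
  "trivial_lmset pt =
     LMSet_obj (trivial_monoid pt) {pt} (restrict (\<lambda>_. pt) ({pt} \<times> {pt}))"

definition prod_lmset :: "('u \<Rightarrow> 'u \<Rightarrow> 'u) \<Rightarrow> 'u lmset \<Rightarrow> 'u lmset \<Rightarrow> 'u lmset" where
  "prod_lmset pr A B =
     (let M = prod_monoid pr (mon A) (mon B); X = pair_set pr (pts A) (pts B) in
      LMSet_obj M X (restrict
        (\<lambda>(m, x). pr (act A (pr_fst pr m, pr_fst pr x)) (act B (pr_snd pr m, pr_snd pr x)))
        (carrier M \<times> X)))"

definition LMSet_products ::
    "('u \<Rightarrow> 'u \<Rightarrow> 'u) \<Rightarrow> 'u \<Rightarrow> ('u lmset, 'u lmset_arrow) products" where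
  "LMSet_products pr pt = \<lparr>
     terminal_ob = trivial_lmset pt,
     prod_ob = prod_lmset pr,
     proj1 = (\<lambda>A B. Arrow (prod_lmset pr A B)
       (restrict (pr_fst pr) (pair_set pr (carrier (mon A)) (carrier (mon B))),
        restrict (pr_fst pr) (pair_set pr (pts A) (pts B))) A),
     proj2 = (\<lambda>A B. Arrow (prod_lmset pr A B)
       (restrict (pr_snd pr) (pair_set pr (carrier (mon A)) (carrier (mon B))),
        restrict (pr_snd pr) (pair_set pr (pts A) (pts B))) B)\<rparr>"

definition V :: "('u lmset, 'u lmset_arrow, 'u monoid, 'u monoid_arrow) fctr" where
  "V = \<lparr>obj_map = mon, arr_map = (\<lambda>h. Arrow (mon (src h)) (fst (fn h)) (mon (tgt h)))\<rparr>"

end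

theory Submission
  imports Defs
begin

text \<open>The cocartesian lift of a homomorphism \<open>f: M \<rightarrow> N\<close> at an \<open>M\<close>-set \<open>X\<close> is the extension of scalars
  \<open>X \<rightarrow> N \<otimes>\<^sub>M X\<close>, the quotient of \<open>N \<times> X\<close> by the equivalence relation generated by
  \<open>(n f(m), x) \<sim> (n, m x)\<close>. By uniqueness of lifts, an arrow \<open>(f, f0): (M, X) \<rightarrow> (N, Y)\<close> is cocartesian
  iff \<open>(n, x) \<mapsto> n f0(x)\<close> maps \<open>N \<times> X\<close> onto \<open>Y\<close> and its kernel is this relation. The criterion is
  stable under products because the units make the generating relation reflexive, so that a pair
  of equivalences can be performed one coordinate at a time.\<close>

section \<open>Cartesian categories\<close>

lemma (in category) Hom_Obj:
  assumes "f \<in> Hom C a b"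
  shows "a \<in> Obj C" "b \<in> Obj C"
  using assms Dom_Obj Cod_Obj by (auto simp: Hom_def)

lemma Hom_DomCod:
  assumes "f \<in> Hom C a b"
  shows "f \<in> Arr C" "Dom C f = a" "Cod C f = b"
  using assms by (auto simp: Hom_def)

context cartesian_category
begin

lemma proj_Hom:
  assumes "a \<in> Obj C" "b \<in> Obj C"
  shows "proj1 S a b \<in> Hom C (prod_ob S a b) a" "proj2 S a b \<in> Hom C (prod_ob S a b) b"
  using product[OF assms] by (auto simp: is_product_def)

lemma prod_ob_Obj: "a \<in> Obj C \<Longrightarrow> b \<in> Obj C \<Longrightarrow> prod_ob S a b \<in> Obj C"
  using proj_Hom Hom_Obj by blast

lemma pairing_ex1:
  assumes "f \<in> Hom C x a" "g \<in> Hom C x b"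
  shows "\<exists>!h. h \<in> Hom C x (prod_ob S a b) \<and>
    Comp C (proj1 S a b) h = f \<and> Comp C (proj2 S a b) h = g"
  using product[of a b] assms Hom_Obj[OF assms(1)] Hom_Obj[OF assms(2)]
  by (auto simp: is_product_def)

text \<open>\<open>pairing\<close> is a definite description over the domain and codomains read off
  \<open>f\<close> and \<open>g\<close>. Unique existence for arrows with a common source is what
  licenses reading its value.\<close>

lemma pairing_props:
  assumes "f \<in> Hom C x a" "g \<in> Hom C x b"
  shows "pairing C S f g \<in> Hom C x (prod_ob S a b)"
    and "Comp C (proj1 S a b) (pairing C S f g) = f"
    and "Comp C (proj2 S a b) (pairing C S f g) = g"
  using theI'[OF pairing_ex1[OF assms]] Hom_DomCod[OF assms(1)] Hom_DomCod[OF assms(2)]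
  by (simp_all add: pairing_def)

lemma pairing_eqI:
  assumes "f \<in> Hom C x a" "g \<in> Hom C x b" "h \<in> Hom C x (prod_ob S a b)"
    and "Comp C (proj1 S a b) h = f" "Comp C (proj2 S a b) h = g"
  shows "pairing C S f g = h"
  using pairing_ex1[OF assms(1,2)] pairing_props[OF assms(1,2)] assms(3-) by blast

lemma prod_arr_props:
  assumes "f \<in> Hom C a b" "g \<in> Hom C c d"
  shows "prod_arr C S f g \<in> Hom C (prod_ob S a c) (prod_ob S b d)"
    and "Comp C (proj1 S b d) (prod_arr C S f g) = Comp C f (proj1 S a c)"
    and "Comp C (proj2 S b d) (prod_arr C S f g) = Comp C g (proj2 S a c)"
proof -
  have 1: "Comp C f (proj1 S a c) \<in> Hom C (prod_ob S a c) b"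
    "Comp C g (proj2 S a c) \<in> Hom C (prod_ob S a c) d"
    using Comp_Hom[OF proj_Hom(1) assms(1)] Comp_Hom[OF proj_Hom(2) assms(2)]
      Hom_Obj[OF assms(1)] Hom_Obj[OF assms(2)] by simp_all
  show "prod_arr C S f g \<in> Hom C (prod_ob S a c) (prod_ob S b d)"
    "Comp C (proj1 S b d) (prod_arr C S f g) = Comp C f (proj1 S a c)"
    "Comp C (proj2 S b d) (prod_arr C S f g) = Comp C g (proj2 S a c)"
    using pairing_props[OF 1] Hom_DomCod[OF assms(1)] Hom_DomCod[OF assms(2)]
    by (simp_all add: prod_arr_def)
qed

end

text \<open>Product arrows and associators are built from projections by composition and pairing,
  and unitors are projections. Hence a functor that strictly preserves the chosen terminal object
  and product cones preserves all of this structure, once it is known to preserve pairings.\<close>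

lemma strict_cartesian_functorI:
  assumes "functor_between X B P" "cartesian_category X S" "cartesian_category B T"
    and tm: "obj_map P (terminal_ob S) = terminal_ob T"
    and prod: "\<And>a b. a \<in> Obj X \<Longrightarrow> b \<in> Obj X
      \<Longrightarrow> obj_map P (prod_ob S a b) = prod_ob T (obj_map P a) (obj_map P b)"
    and pr1: "\<And>a b. a \<in> Obj X \<Longrightarrow> b \<in> Obj X
      \<Longrightarrow> arr_map P (proj1 S a b) = proj1 T (obj_map P a) (obj_map P b)"
    and pr2: "\<And>a b. a \<in> Obj X \<Longrightarrow> b \<in> Obj X
      \<Longrightarrow> arr_map P (proj2 S a b) = proj2 T (obj_map P a) (obj_map P b)"
  shows "strict_cartesian_functor X S B T P"
proof -
  interpret functor_between X B P by fact
  interpret X: cartesian_category X S by fact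
  interpret B: cartesian_category B T by fact
  \<comment> \<open>Functoriality carries the two projection equations of the pairing in
    \<open>X\<close> to those that characterise the pairing in \<open>B\<close>, so uniqueness in
    \<open>B\<close> identifies the two.\<close>
  have pairing: "arr_map P (pairing X S f g) = pairing B T (arr_map P f) (arr_map P g)"
    if f: "f \<in> Hom X x a" and g: "g \<in> Hom X x b" for f g x a b
  proof -
    have ob: "a \<in> Obj X" "b \<in> Obj X" using f g X.Hom_Obj by blast+
    note p = X.pairing_props[OF f g]
    show ?thesis
    proof (rule B.pairing_eqI[symmetric])
      show "arr_map P f \<in> Hom B (obj_map P x) (obj_map P a)"
        "arr_map P g \<in> Hom B (obj_map P x) (obj_map P b)"
        using f g arr_map_Hom by blast+
      show "arr_map P (pairing X S f g) \<in> Hom B (obj_map P x) (prod_ob T (obj_map P a) (obj_map P b))"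
        using arr_map_Hom[OF p(1)] prod[OF ob] by simp
      show "Comp B (proj1 T (obj_map P a) (obj_map P b)) (arr_map P (pairing X S f g)) = arr_map P f"
        using arr_map_Comp[OF p(1) X.proj_Hom(1)[OF ob]] p(2) pr1[OF ob] by simp
      show "Comp B (proj2 T (obj_map P a) (obj_map P b)) (arr_map P (pairing X S f g)) = arr_map P g"
        using arr_map_Comp[OF p(1) X.proj_Hom(2)[OF ob]] p(3) pr2[OF ob] by simp
    qed
  qed
  show ?thesis
  proof unfold_locales
    fix f g assume "f \<in> Arr X" "g \<in> Arr X"
    then obtain a b c d where f: "f \<in> Hom X a b" and g: "g \<in> Hom X c d"
      by (auto simp: Hom_def)
    have ob: "a \<in> Obj X" "c \<in> Obj X" using f g X.Hom_Obj by blast+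
    note p = X.proj_Hom[OF ob]
    show "arr_map P (prod_arr X S f g) = prod_arr B T (arr_map P f) (arr_map P g)"
      using pairing[OF X.Comp_Hom[OF p(1) f] X.Comp_Hom[OF p(2) g]]
        arr_map_Comp[OF p(1) f] arr_map_Comp[OF p(2) g] pr1[OF ob] pr2[OF ob]
        Hom_DomCod[OF f] Hom_DomCod[OF g]
        Hom_DomCod[OF arr_map_Hom[OF f]] Hom_DomCod[OF arr_map_Hom[OF g]]
      by (simp add: prod_arr_def)
  next
    fix a b c assume ob: "a \<in> Obj X" "b \<in> Obj X" "c \<in> Obj X"
    note ab = X.prod_ob_Obj[OF ob(1,2)]
    note p = X.proj_Hom[OF ab ob(3)] and q = X.proj_Hom[OF ob(1,2)]
    note c = X.Comp_Hom[OF p(1) q(1)] X.Comp_Hom[OF p(1) q(2)]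
    show "arr_map P (associator X S a b c)
      = associator B T (obj_map P a) (obj_map P b) (obj_map P c)"
      using pairing[OF c(1) X.pairing_props(1)[OF c(2) p(2)]] pairing[OF c(2) p(2)]
        arr_map_Comp[OF p(1) q(1)] arr_map_Comp[OF p(1) q(2)]
      by (simp add: associator_def pr1 pr2 prod ob ab)
  \<comment> \<open>Unitors are projections with the terminal object as one factor, so
    \<open>pr1\<close>, \<open>pr2\<close> and \<open>tm\<close> cover them;
    \<open>X.terminal\<close> supplies membership of that object in \<open>Obj X\<close>.\<close>
  qed (use assms X.terminal in \<open>auto simp: left_unitor_def right_unitor_def is_terminal_def\<close>)
qed

section \<open>Monoids and actions\<close>

lemma monoid_objects_monoid: "M \<in> monoid_objects U \<Longrightarrow> monoid M"
  by (simp add: monoid_objects_def)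

lemma monoid_objects_small: "M \<in> monoid_objects U \<Longrightarrow> carrier M \<in> U"
  by (simp add: monoid_objects_def)

lemma monoid_hom_iff:
  "f \<in> monoid_hom M N \<longleftrightarrow> f \<in> carrier M \<rightarrow>\<^sub>E carrier N \<and> f \<one>\<^bsub>M\<^esub> = \<one>\<^bsub>N\<^esub> \<and>
    (\<forall>x\<in>carrier M. \<forall>y\<in>carrier M. f (x \<otimes>\<^bsub>M\<^esub> y) = f x \<otimes>\<^bsub>N\<^esub> f y)"
  by (auto simp: monoid_hom_def hom_def PiE_def)

lemma monoid_hom_closed: "f \<in> monoid_hom M N \<Longrightarrow> x \<in> carrier M \<Longrightarrow> f x \<in> carrier N"
  by (auto simp: monoid_hom_iff)

lemma lmset_objects_iff:
  "A \<in> lmset_objects U \<longleftrightarrow>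
    mon A \<in> monoid_objects U \<and> pts A \<in> U \<and> left_action (mon A) (pts A) (act A)"
  by (cases A) (auto simp: lmset_objects_def)

lemma lmset_objectsD:
  assumes "A \<in> lmset_objects U"
  shows "mon A \<in> monoid_objects U" "monoid (mon A)"
    and "m \<in> carrier (mon A) \<Longrightarrow> x \<in> pts A \<Longrightarrow> act A (m, x) \<in> pts A"
    and "x \<in> pts A \<Longrightarrow> act A (\<one>\<^bsub>mon A\<^esub>, x) = x"
    and "m \<in> carrier (mon A) \<Longrightarrow> n \<in> carrier (mon A) \<Longrightarrow> x \<in> pts A
      \<Longrightarrow> act A (m \<otimes>\<^bsub>mon A\<^esub> n, x) = act A (m, act A (n, x))"
  using assms by (auto simp: lmset_objects_iff left_action_def monoid_objects_def)

lemma lmset_hom_iff: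
  "(f, f0) \<in> lmset_hom A B \<longleftrightarrow> f \<in> monoid_hom (mon A) (mon B) \<and> f0 \<in> pts A \<rightarrow>\<^sub>E pts B \<and>
    (\<forall>m\<in>carrier (mon A). \<forall>x\<in>pts A. f0 (act A (m, x)) = act B (f m, f0 x))"
  by (simp add: lmset_hom_def)

lemma Mon_simps [simp]:
  "Obj (Mon U) = monoid_objects U" "Dom (Mon U) = src" "Cod (Mon U) = tgt"
  "Id (Mon U) M = Arrow M (restrict id (carrier M)) M"
  "Comp (Mon U) g f = Arrow (src f) (compose (carrier (src f)) (fn g) (fn f)) (tgt g)"
  by (simp_all add: Mon_def)

lemma LMSet_simps [simp]:
  "Obj (LMSet U) = lmset_objects U" "Dom (LMSet U) = src" "Cod (LMSet U) = tgt"
  "Id (LMSet U) A = Arrow A (restrict id (carrier (mon A)), restrict id (pts A)) A"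
  "Comp (LMSet U) g f = Arrow (src f)
       (compose (carrier (mon (src f))) (fst (fn g)) (fst (fn f)),
        compose (pts (src f)) (snd (fn g)) (snd (fn f))) (tgt g)"
  by (simp_all add: LMSet_def)

lemma V_simps [simp]:
  "obj_map V = mon" "arr_map V h = Arrow (mon (src h)) (fst (fn h)) (mon (tgt h))"
  by (simp_all add: V_def)

lemma Hom_Mon_iff:
  "h \<in> Hom (Mon U) M N \<longleftrightarrow> (\<exists>f. h = Arrow M f N \<and>
    M \<in> monoid_objects U \<and> N \<in> monoid_objects U \<and> f \<in> monoid_hom M N)"
  by (auto simp: Hom_def) (auto simp: Mon_def)

lemma Hom_LMSet_iff:
  "h \<in> Hom (LMSet U) A B \<longleftrightarrow> (\<exists>f f0. h = Arrow A (f, f0) B \<and>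
    A \<in> lmset_objects U \<and> B \<in> lmset_objects U \<and> (f, f0) \<in> lmset_hom A B)"
  by (auto simp: Hom_def) (auto simp: LMSet_def)

section \<open>Composition of extensional functions, homomorphisms and equivariant maps\<close>

lemma PiE_singleton_range: "f \<in> A \<rightarrow>\<^sub>E {c} \<Longrightarrow> f = (\<lambda>_\<in>A. c)"
  by (auto simp: fun_eq_iff PiE_def extensional_def Pi_def)

lemma compose_PiE: "f \<in> A \<rightarrow>\<^sub>E B \<Longrightarrow> g \<in> B \<rightarrow>\<^sub>E C \<Longrightarrow> compose A g f \<in> A \<rightarrow>\<^sub>E C"
  by (auto simp: compose_def)

text \<open>Restricted composition satisfies the category laws as equalities of HOL functions only
  because extensional functions are \<open>undefined\<close> off their domain, where both sides must
  also agree.\<close>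

lemma compose_restrict_id: "f \<in> A \<rightarrow>\<^sub>E B \<Longrightarrow> compose A f (restrict id A) = f"
  by (auto simp: fun_eq_iff compose_def restrict_def PiE_def extensional_def)

lemma restrict_id_compose: "f \<in> A \<rightarrow>\<^sub>E B \<Longrightarrow> compose A (restrict id B) f = f"
  by (auto simp: fun_eq_iff compose_def restrict_def PiE_def extensional_def Pi_def)

lemma compose_compose:
  "f \<in> A \<rightarrow>\<^sub>E B \<Longrightarrow> compose A h (compose A g f) = compose A (compose B h g) f"
  by (auto simp: fun_eq_iff compose_def restrict_def PiE_def Pi_def)

lemma monoid_hom_PiE: "f \<in> monoid_hom M N \<Longrightarrow> f \<in> carrier M \<rightarrow>\<^sub>E carrier N"
  by (simp add: monoid_hom_iff)

lemma lmset_hom_PiE: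
  assumes "(f, f0) \<in> lmset_hom A B"
  shows "f \<in> carrier (mon A) \<rightarrow>\<^sub>E carrier (mon B)" "f0 \<in> pts A \<rightarrow>\<^sub>E pts B"
  using assms by (simp_all add: lmset_hom_iff monoid_hom_PiE)

lemma monoid_hom_id: "monoid M \<Longrightarrow> restrict id (carrier M) \<in> monoid_hom M M"
  by (auto simp: monoid_hom_iff monoid.m_closed)

lemma monoid_hom_compose:
  assumes "monoid M" "f \<in> monoid_hom M N" "g \<in> monoid_hom N K"
  shows "compose (carrier M) g f \<in> monoid_hom M K"
  using assms
  by (auto simp: monoid_hom_iff compose_PiE compose_eq monoid.m_closed PiE_def Pi_def)

lemma lmset_hom_compose:
  assumes "A \<in> lmset_objects U" "(f, f0) \<in> lmset_hom A B" "(g, g0) \<in> lmset_hom B C"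
  shows "(compose (carrier (mon A)) g f, compose (pts A) g0 f0) \<in> lmset_hom A C"
  using assms lmset_objectsD[OF assms(1)]
  unfolding lmset_hom_iff
  by (auto simp: monoid_hom_compose compose_PiE compose_eq monoid_hom_closed PiE_def Pi_def)

section \<open>The categories of monoids and of left actions, and the functor between them\<close>

lemma category_Mon: "category (Mon U)"
proof
  fix f assume "f \<in> Arr (Mon U)"
  then show "Dom (Mon U) f \<in> Obj (Mon U)" "Cod (Mon U) f \<in> Obj (Mon U)"
    by (auto simp: Mon_def)
next
  fix f g h a b c d
  assume "f \<in> Hom (Mon U) a b" "g \<in> Hom (Mon U) b c" "h \<in> Hom (Mon U) c d"
  then show "Comp (Mon U) h (Comp (Mon U) g f) = Comp (Mon U) (Comp (Mon U) h g) f"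
    by (auto simp: Hom_Mon_iff intro: compose_compose[OF monoid_hom_PiE])
qed (auto simp: Hom_Mon_iff monoid_hom_id monoid_objects_monoid monoid_hom_compose
    compose_restrict_id[OF monoid_hom_PiE] restrict_id_compose[OF monoid_hom_PiE])

lemma category_LMSet: "category (LMSet U)"
proof
  fix f assume "f \<in> Arr (LMSet U)"
  then show "Dom (LMSet U) f \<in> Obj (LMSet U)" "Cod (LMSet U) f \<in> Obj (LMSet U)"
    by (auto simp: LMSet_def)
next
  fix a assume "a \<in> Obj (LMSet U)"
  then show "Id (LMSet U) a \<in> Hom (LMSet U) a a"
    using lmset_objectsD[of a U] by (auto simp: Hom_LMSet_iff lmset_hom_iff monoid_hom_id)
next
  fix f g a b c assume "f \<in> Hom (LMSet U) a b" "g \<in> Hom (LMSet U) b c"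
  then show "Comp (LMSet U) g f \<in> Hom (LMSet U) a c"
    by (auto simp: Hom_LMSet_iff lmset_hom_compose)
next
  fix f g h a b c d
  assume "f \<in> Hom (LMSet U) a b" "g \<in> Hom (LMSet U) b c" "h \<in> Hom (LMSet U) c d"
  \<comment> \<open>The composite of \<open>h\<close> and \<open>g\<close> is restricted to the
    carriers of \<open>src g\<close>. Knowing \<open>src g = b\<close> makes these the sets into
    which \<open>f'\<close> and \<open>f0\<close> map, as \<open>compose_compose\<close>
    demands.\<close>
  then obtain f' f0 where "f = Arrow a (f', f0) b" "(f', f0) \<in> lmset_hom a b"
    and "src g = b"
    by (auto simp: Hom_LMSet_iff)
  then show "Comp (LMSet U) h (Comp (LMSet U) g f) = Comp (LMSet U) (Comp (LMSet U) h g) f"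
    by (simp add: compose_compose[OF lmset_hom_PiE(1)] compose_compose[OF lmset_hom_PiE(2)])
next
  fix f a b assume "f \<in> Hom (LMSet U) a b"
  then obtain f' f0 where "f = Arrow a (f', f0) b" "(f', f0) \<in> lmset_hom a b"
    by (auto simp: Hom_LMSet_iff)
  then show "Comp (LMSet U) f (Id (LMSet U) a) = f" "Comp (LMSet U) (Id (LMSet U) b) f = f"
    by (simp_all add: compose_restrict_id[OF lmset_hom_PiE(1)] compose_restrict_id[OF lmset_hom_PiE(2)]
      restrict_id_compose[OF lmset_hom_PiE(1)] restrict_id_compose[OF lmset_hom_PiE(2)])
qed

lemma functor_V: "functor_between (LMSet U) (Mon U) V"
proof -
  interpret X: category "LMSet U" by (rule category_LMSet)
  interpret B: category "Mon U" by (rule category_Mon)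
  show ?thesis
    by unfold_locales (auto simp: Hom_LMSet_iff Hom_Mon_iff lmset_hom_iff lmset_objectsD)
qed

section \<open>Chosen finite products of monoids and of actions, and their preservation by
  \<open>V\<close>\<close>

context universe
begin

lemma pr_fst_pr [simp]: "pr_fst pr (pr a b) = a"
  by (simp add: pr_fst_def pr_inject)

lemma pr_snd_pr [simp]: "pr_snd pr (pr a b) = b"
  by (simp add: pr_snd_def pr_inject)

lemma pr_in_pair_set [simp]: "pr a b \<in> pair_set pr A B \<longleftrightarrow> a \<in> A \<and> b \<in> B"
  by (auto simp: pair_set_def pr_inject)

lemma pair_setE:
  assumes "z \<in> pair_set pr A B"
  obtains a b where "z = pr a b" "a \<in> A" "b \<in> B"
  using assms by (auto simp: pair_set_def)

lemma ball_pair_set: "(\<forall>z\<in>pair_set pr A B. P z) \<longleftrightarrow> (\<forall>a\<in>A. \<forall>b\<in>B. P (pr a b))"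
  by (auto simp: pair_set_def)

text \<open>This is the existence half of the product property for bare functions;
  \<open>pairing_fun_eq\<close> is the uniqueness half. Both are applied to monoid components and to
  point components of arrows.\<close>

lemma compose_proj_pairing:
  assumes "f \<in> X \<rightarrow>\<^sub>E A" "g \<in> X \<rightarrow>\<^sub>E B"
  shows "compose X (restrict (pr_fst pr) (pair_set pr A B)) (\<lambda>z\<in>X. pr (f z) (g z)) = f"
    and "compose X (restrict (pr_snd pr) (pair_set pr A B)) (\<lambda>z\<in>X. pr (f z) (g z)) = g"
  using assms by (auto simp: fun_eq_iff compose_def restrict_def PiE_def extensional_def Pi_def)

lemma pairing_fun_eq:
  assumes h: "h \<in> X \<rightarrow>\<^sub>E pair_set pr A B"
    and f: "compose X (restrict (pr_fst pr) (pair_set pr A B)) h = f"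
    and g: "compose X (restrict (pr_snd pr) (pair_set pr A B)) h = g"
  shows "h = (\<lambda>z\<in>X. pr (f z) (g z))"
proof
  fix z
  show "h z = (\<lambda>z\<in>X. pr (f z) (g z)) z"
  proof (cases "z \<in> X")
    case True
    then have "h z \<in> pair_set pr A B" using h by auto
    then show ?thesis using True f g by (auto simp: compose_def elim: pair_setE)
  qed (use h in \<open>auto simp: PiE_def extensional_def\<close>)
qed

lemma prod_monoid_simps [simp]:
  "carrier (prod_monoid pr M N) = pair_set pr (carrier M) (carrier N)"
  "\<one>\<^bsub>prod_monoid pr M N\<^esub> = pr \<one>\<^bsub>M\<^esub> \<one>\<^bsub>N\<^esub>"
  "a \<in> carrier M \<Longrightarrow> b \<in> carrier N \<Longrightarrow> c \<in> carrier M \<Longrightarrow> d \<in> carrier N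
    \<Longrightarrow> pr a b \<otimes>\<^bsub>prod_monoid pr M N\<^esub> pr c d = pr (a \<otimes>\<^bsub>M\<^esub> c) (b \<otimes>\<^bsub>N\<^esub> d)"
  by (simp_all add: prod_monoid_def Let_def)

lemma prod_monoid_objects:
  assumes "M \<in> monoid_objects U" "N \<in> monoid_objects U"
  shows "prod_monoid pr M N \<in> monoid_objects U"
proof -
  interpret M: monoid M using assms monoid_objects_monoid by blast
  interpret N: monoid N using assms monoid_objects_monoid by blast
  have "monoid (prod_monoid pr M N)"
    by (rule monoidI) (auto elim!: pair_setE simp: M.m_assoc N.m_assoc)
  moreover have "pair_set pr (carrier M) (carrier N) \<in> U"
    using assms pair_set_small monoid_objects_small by blast
  ultimately show ?thesis
    \<comment> \<open>The second \<open>auto\<close> unfolds the product for the clause on default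
      values: its multiplication is \<open>undefined\<close> off the product carrier.\<close>
    by (auto simp: monoid_objects_def) (auto simp: prod_monoid_def Let_def)
qed

lemma trivial_monoid_objects: "trivial_monoid pt \<in> monoid_objects U"
  by (auto simp: monoid_objects_def trivial_monoid_def point_small intro!: monoidI)

lemma prod_lmset_simps [simp]:
  "mon (prod_lmset pr A B) = prod_monoid pr (mon A) (mon B)"
  "pts (prod_lmset pr A B) = pair_set pr (pts A) (pts B)"
  "m \<in> carrier (mon A) \<Longrightarrow> n \<in> carrier (mon B) \<Longrightarrow> x \<in> pts A \<Longrightarrow> y \<in> pts B
    \<Longrightarrow> act (prod_lmset pr A B) (pr m n, pr x y) = pr (act A (m, x)) (act B (n, y))"
  by (simp_all add: prod_lmset_def Let_def)

lemma prod_lmset_objects: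
  assumes "A \<in> lmset_objects U" "B \<in> lmset_objects U"
  shows "prod_lmset pr A B \<in> lmset_objects U"
proof -
  interpret M: monoid "mon A" using assms lmset_objectsD by blast
  interpret N: monoid "mon B" using assms lmset_objectsD by blast
  note A = lmset_objectsD[OF assms(1)] and B = lmset_objectsD[OF assms(2)]
  have "act (prod_lmset pr A B) \<in> carrier (prod_monoid pr (mon A) (mon B)) \<times> pts (prod_lmset pr A B)
    \<rightarrow>\<^sub>E pts (prod_lmset pr A B)"
    using A B by (auto simp: prod_lmset_def Let_def elim!: pair_setE)
  then have "left_action (prod_monoid pr (mon A) (mon B)) (pts (prod_lmset pr A B)) (act (prod_lmset pr A B))"
    using A B by (auto simp: left_action_def ball_pair_set)
  then show ?thesis
    using assms prod_monoid_objects by (auto simp: lmset_objects_iff pair_set_small)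
qed

lemma trivial_lmset_objects: "trivial_lmset pt \<in> lmset_objects U"
  using trivial_monoid_objects
  by (auto simp: lmset_objects_iff trivial_lmset_def left_action_def point_small)
    (auto simp: trivial_monoid_def)

lemma Mon_products_simps [simp]:
  "terminal_ob (Mon_products pr pt) = trivial_monoid pt"
  "prod_ob (Mon_products pr pt) = prod_monoid pr"
  "proj1 (Mon_products pr pt) M N = Arrow (prod_monoid pr M N)
       (restrict (pr_fst pr) (pair_set pr (carrier M) (carrier N))) M"
  "proj2 (Mon_products pr pt) M N = Arrow (prod_monoid pr M N)
       (restrict (pr_snd pr) (pair_set pr (carrier M) (carrier N))) N"
  by (simp_all add: Mon_products_def)

lemma LMSet_products_simps [simp]:
  "terminal_ob (LMSet_products pr pt) = trivial_lmset pt"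
  "prod_ob (LMSet_products pr pt) = prod_lmset pr"
  "proj1 (LMSet_products pr pt) A B = Arrow (prod_lmset pr A B)
       (restrict (pr_fst pr) (pair_set pr (carrier (mon A)) (carrier (mon B))),
        restrict (pr_fst pr) (pair_set pr (pts A) (pts B))) A"
  "proj2 (LMSet_products pr pt) A B = Arrow (prod_lmset pr A B)
       (restrict (pr_snd pr) (pair_set pr (carrier (mon A)) (carrier (mon B))),
        restrict (pr_snd pr) (pair_set pr (pts A) (pts B))) B"
  by (simp_all add: LMSet_products_def)

lemma monoid_hom_proj:
  assumes "monoid M" "monoid N"
  shows "restrict (pr_fst pr) (pair_set pr (carrier M) (carrier N)) \<in> monoid_hom (prod_monoid pr M N) M"
    and "restrict (pr_snd pr) (pair_set pr (carrier M) (carrier N)) \<in> monoid_hom (prod_monoid pr M N) N"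
proof -
  interpret M: monoid M by fact
  interpret N: monoid N by fact
  show "restrict (pr_fst pr) (pair_set pr (carrier M) (carrier N)) \<in> monoid_hom (prod_monoid pr M N) M"
    "restrict (pr_snd pr) (pair_set pr (carrier M) (carrier N)) \<in> monoid_hom (prod_monoid pr M N) N"
    by (auto simp: monoid_hom_iff ball_pair_set elim!: pair_setE)
qed

lemma monoid_hom_pairing:
  assumes "monoid K" "f \<in> monoid_hom K M" "g \<in> monoid_hom K N"
  shows "(\<lambda>z\<in>carrier K. pr (f z) (g z)) \<in> monoid_hom K (prod_monoid pr M N)"
proof -
  interpret K: monoid K by fact
  show ?thesis
    using assms(2,3) by (auto simp: monoid_hom_iff PiE_def Pi_def)
qed

text \<open>The structure on a product is componentwise, so the paired function is a homomorphism
  when its components are. Extensionality makes the mediating arrow unique as a HOL function, and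
  likewise the constant map into the one-point monoid.\<close>

lemma cartesian_Mon: "cartesian_category (Mon U) (Mon_products pr pt)"
proof -
  interpret category "Mon U" by (rule category_Mon)
  show ?thesis
  proof
    have "\<exists>!f. f \<in> Hom (Mon U) M (trivial_monoid pt)" if M: "M \<in> monoid_objects U" for M
    proof
      interpret monoid M using M monoid_objects_monoid by blast
      show "Arrow M (\<lambda>_\<in>carrier M. pt) (trivial_monoid pt) \<in> Hom (Mon U) M (trivial_monoid pt)"
        using M trivial_monoid_objects
        by (auto simp: Hom_Mon_iff monoid_hom_iff trivial_monoid_def)
      fix f assume "f \<in> Hom (Mon U) M (trivial_monoid pt)"
      then show "f = Arrow M (\<lambda>_\<in>carrier M. pt) (trivial_monoid pt)"
        by (auto simp: Hom_Mon_iff trivial_monoid_def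
          dest!: monoid_hom_PiE intro: PiE_singleton_range)
    qed
    then show "is_terminal (Mon U) (terminal_ob (Mon_products pr pt))"
      using trivial_monoid_objects by (simp add: is_terminal_def)
  next
    fix M N assume MN: "M \<in> Obj (Mon U)" "N \<in> Obj (Mon U)"
    then have mon: "monoid M" "monoid N" "prod_monoid pr M N \<in> monoid_objects U"
      using monoid_objects_monoid prod_monoid_objects by auto
    have "\<exists>!h. h \<in> Hom (Mon U) K (prod_monoid pr M N) \<and>
        Comp (Mon U) (proj1 (Mon_products pr pt) M N) h = f \<and>
        Comp (Mon U) (proj2 (Mon_products pr pt) M N) h = g"
      if K: "K \<in> monoid_objects U" and fg: "f \<in> Hom (Mon U) K M" "g \<in> Hom (Mon U) K N" for K f g
    proof
      let ?h = "Arrow K (\<lambda>z\<in>carrier K. pr (fn f z) (fn g z)) (prod_monoid pr M N)"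
      from fg obtain f' g' where f': "f = Arrow K f' M" "f' \<in> monoid_hom K M"
        and g': "g = Arrow K g' N" "g' \<in> monoid_hom K N"
        by (auto simp: Hom_Mon_iff)
      show "?h \<in> Hom (Mon U) K (prod_monoid pr M N) \<and>
        Comp (Mon U) (proj1 (Mon_products pr pt) M N) ?h = f \<and>
        Comp (Mon U) (proj2 (Mon_products pr pt) M N) ?h = g"
        using f' g' K mon compose_proj_pairing[OF monoid_hom_PiE[OF f'(2)] monoid_hom_PiE[OF g'(2)]]
        by (simp add: Hom_Mon_iff monoid_hom_pairing monoid_objects_monoid)
      fix h assume h: "h \<in> Hom (Mon U) K (prod_monoid pr M N) \<and>
        Comp (Mon U) (proj1 (Mon_products pr pt) M N) h = f \<and>
        Comp (Mon U) (proj2 (Mon_products pr pt) M N) h = g"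
      then obtain k where k: "h = Arrow K k (prod_monoid pr M N)"
        and hom: "k \<in> monoid_hom K (prod_monoid pr M N)"
        by (auto simp: Hom_Mon_iff)
      then show "h = ?h"
        using h f' g' monoid_hom_PiE[OF hom] pairing_fun_eq[of k] by simp
    qed
    then show "is_product (Mon U) M N (prod_ob (Mon_products pr pt) M N)
        (proj1 (Mon_products pr pt) M N) (proj2 (Mon_products pr pt) M N)"
      using MN mon by (auto simp: is_product_def Hom_Mon_iff monoid_hom_proj)
  qed
qed

lemma lmset_hom_proj:
  assumes "A \<in> lmset_objects U" "B \<in> lmset_objects U"
  shows "(restrict (pr_fst pr) (pair_set pr (carrier (mon A)) (carrier (mon B))),
      restrict (pr_fst pr) (pair_set pr (pts A) (pts B))) \<in> lmset_hom (prod_lmset pr A B) A"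
    and "(restrict (pr_snd pr) (pair_set pr (carrier (mon A)) (carrier (mon B))),
      restrict (pr_snd pr) (pair_set pr (pts A) (pts B))) \<in> lmset_hom (prod_lmset pr A B) B"
  using lmset_objectsD[OF assms(1)] lmset_objectsD[OF assms(2)]
  by (auto simp: lmset_hom_iff monoid_hom_proj ball_pair_set elim!: pair_setE)

lemma lmset_hom_pairing:
  assumes "D \<in> lmset_objects U" "(f, f0) \<in> lmset_hom D A" "(g, g0) \<in> lmset_hom D B"
  shows "(\<lambda>z\<in>carrier (mon D). pr (f z) (g z), \<lambda>z\<in>pts D. pr (f0 z) (g0 z))
    \<in> lmset_hom D (prod_lmset pr A B)"
  using lmset_objectsD[OF assms(1)] assms(2,3)
  unfolding lmset_hom_iff
  by (auto simp: monoid_hom_pairing monoid_hom_closed PiE_def Pi_def)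

text \<open>The argument for monoids is run twice in parallel, on scalars and on points.
  Equivariance of the paired maps holds because the product action is componentwise.\<close>

lemma cartesian_LMSet: "cartesian_category (LMSet U) (LMSet_products pr pt)"
proof -
  interpret category "LMSet U" by (rule category_LMSet)
  show ?thesis
  proof
    have "\<exists>!f. f \<in> Hom (LMSet U) A (trivial_lmset pt)" if A: "A \<in> lmset_objects U" for A
    proof
      interpret monoid "mon A" using A lmset_objectsD by blast
      let ?f = "Arrow A (\<lambda>_\<in>carrier (mon A). pt, \<lambda>_\<in>pts A. pt) (trivial_lmset pt)"
      show "?f \<in> Hom (LMSet U) A (trivial_lmset pt)"
        using A trivial_lmset_objects lmset_objectsD[OF A]
        by (auto simp: Hom_LMSet_iff lmset_hom_iff monoid_hom_iff)
          (auto simp: trivial_lmset_def trivial_monoid_def)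
      fix f assume "f \<in> Hom (LMSet U) A (trivial_lmset pt)"
      then show "f = ?f"
        by (auto simp: Hom_LMSet_iff lmset_hom_iff trivial_monoid_def trivial_lmset_def
          dest!: monoid_hom_PiE intro: PiE_singleton_range)
    qed
    then show "is_terminal (LMSet U) (terminal_ob (LMSet_products pr pt))"
      using trivial_lmset_objects by (simp add: is_terminal_def)
  next
    fix A B assume AB: "A \<in> Obj (LMSet U)" "B \<in> Obj (LMSet U)"
    then have ob: "prod_lmset pr A B \<in> lmset_objects U"
      using prod_lmset_objects by auto
    have "\<exists>!h. h \<in> Hom (LMSet U) D (prod_lmset pr A B) \<and>
        Comp (LMSet U) (proj1 (LMSet_products pr pt) A B) h = f \<and>
        Comp (LMSet U) (proj2 (LMSet_products pr pt) A B) h = g"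
      if D: "D \<in> lmset_objects U" and fg: "f \<in> Hom (LMSet U) D A" "g \<in> Hom (LMSet U) D B" for D f g
    proof
      let ?h = "Arrow D (\<lambda>z\<in>carrier (mon D). pr (fst (fn f) z) (fst (fn g) z),
        \<lambda>z\<in>pts D. pr (snd (fn f) z) (snd (fn g) z)) (prod_lmset pr A B)"
      from fg obtain f' f0 g' g0 where f': "f = Arrow D (f', f0) A" "(f', f0) \<in> lmset_hom D A"
        and g': "g = Arrow D (g', g0) B" "(g', g0) \<in> lmset_hom D B"
        by (auto simp: Hom_LMSet_iff)
      note p = lmset_hom_PiE[OF f'(2)] lmset_hom_PiE[OF g'(2)]
      show "?h \<in> Hom (LMSet U) D (prod_lmset pr A B) \<and>
        Comp (LMSet U) (proj1 (LMSet_products pr pt) A B) ?h = f \<and>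
        Comp (LMSet U) (proj2 (LMSet_products pr pt) A B) ?h = g"
        using f' g' D ob compose_proj_pairing[OF p(1,3)] compose_proj_pairing[OF p(2,4)]
        by (simp add: Hom_LMSet_iff lmset_hom_pairing)
      fix h assume h: "h \<in> Hom (LMSet U) D (prod_lmset pr A B) \<and>
        Comp (LMSet U) (proj1 (LMSet_products pr pt) A B) h = f \<and>
        Comp (LMSet U) (proj2 (LMSet_products pr pt) A B) h = g"
      then obtain k k0 where k: "h = Arrow D (k, k0) (prod_lmset pr A B)"
        and hom: "(k, k0) \<in> lmset_hom D (prod_lmset pr A B)"
        by (auto simp: Hom_LMSet_iff)
      then show "h = ?h"
        using h f' g' lmset_hom_PiE[OF hom] pairing_fun_eq[of k] pairing_fun_eq[of k0] by simp
    qed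
    then show "is_product (LMSet U) A B (prod_ob (LMSet_products pr pt) A B)
        (proj1 (LMSet_products pr pt) A B) (proj2 (LMSet_products pr pt) A B)"
      using AB ob by (auto simp: is_product_def Hom_LMSet_iff lmset_hom_proj)
  qed
qed

text \<open>The chosen product of actions has the chosen product of monoids as its monoid, and its
  projections have the monoid projections as first components. Preservation is therefore a matter of
  equalities that simplification decides.\<close>

lemma strict_cartesian_V:
  "strict_cartesian_functor (LMSet U) (LMSet_products pr pt) (Mon U) (Mon_products pr pt) V"
proof (rule strict_cartesian_functorI[OF functor_V cartesian_LMSet cartesian_Mon])
  show "obj_map V (terminal_ob (LMSet_products pr pt)) = terminal_ob (Mon_products pr pt)"
    by (simp add: trivial_lmset_def)
qed simp_all

end

section \<open>Extension of scalars\<close>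

text \<open>The equivalence on pairs \<open>(n, x)\<close> whose quotient is the extension of
  scalars of \<open>A\<close> along \<open>f\<close>. The rule \<open>refl\<close> is limited to
  \<open>carrier N\<close> and \<open>pts A\<close>, so that for a homomorphism \<open>f\<close> the
  relation never leaves these sets.\<close>

inductive tensor_eq :: "'u monoid \<Rightarrow> ('u \<Rightarrow> 'u) \<Rightarrow> 'u lmset \<Rightarrow> 'u \<Rightarrow> 'u \<Rightarrow> 'u \<Rightarrow> 'u \<Rightarrow> bool"
  for N f A where
  refl: "n \<in> carrier N \<Longrightarrow> x \<in> pts A \<Longrightarrow> tensor_eq N f A n x n x"
| step: "n \<in> carrier N \<Longrightarrow> m \<in> carrier (mon A) \<Longrightarrow> x \<in> pts A
    \<Longrightarrow> tensor_eq N f A (n \<otimes>\<^bsub>N\<^esub> f m) x n (act A (m, x))"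
| sym: "tensor_eq N f A n x n' x' \<Longrightarrow> tensor_eq N f A n' x' n x"
| trans: "tensor_eq N f A n x n' x' \<Longrightarrow> tensor_eq N f A n' x' n'' x''
    \<Longrightarrow> tensor_eq N f A n x n'' x''"

text \<open>Balanced maps factor through the tensor product: the kernel of \<open>h\<close> is an
  equivalence relation that contains the generators.\<close>

lemma tensor_eq_balanced:
  assumes "tensor_eq N f A n x n' x'"
    and "\<And>n m x. n \<in> carrier N \<Longrightarrow> m \<in> carrier (mon A) \<Longrightarrow> x \<in> pts A
      \<Longrightarrow> h (n \<otimes>\<^bsub>N\<^esub> f m) x = h n (act A (m, x))"
  shows "h n x = h n' x'"
  using assms(1) by induction (simp_all add: assms(2))

lemma tensor_eq_closed:
  assumes "tensor_eq N f A n x n' x'"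
    and "N \<in> monoid_objects U" "A \<in> lmset_objects U" "f \<in> monoid_hom (mon A) N"
  shows "n \<in> carrier N" "x \<in> pts A" "n' \<in> carrier N" "x' \<in> pts A"
proof -
  interpret N: monoid N using assms(2) by (rule monoid_objects_monoid)
  have "n \<in> carrier N \<and> x \<in> pts A \<and> n' \<in> carrier N \<and> x' \<in> pts A"
    using assms(1)
    by induction (simp_all add: monoid_hom_closed[OF assms(4)] lmset_objectsD[OF assms(3)])
  then show "n \<in> carrier N" "x \<in> pts A" "n' \<in> carrier N" "x' \<in> pts A"
    by auto
qed

text \<open>Left multiplication by \<open>k\<close> commutes with right multiplication by
  \<open>f m\<close>, by associativity, so generators go to generators. This lets \<open>N\<close>
  act on equivalence classes.\<close>

lemma tensor_eq_mult:
  assumes "tensor_eq N f A n x n' x'"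
    and "N \<in> monoid_objects U" "A \<in> lmset_objects U" "f \<in> monoid_hom (mon A) N" "k \<in> carrier N"
  shows "tensor_eq N f A (k \<otimes>\<^bsub>N\<^esub> n) x (k \<otimes>\<^bsub>N\<^esub> n') x'"
proof -
  interpret N: monoid N using assms(2) by (rule monoid_objects_monoid)
  show ?thesis
    using assms(1)
  proof induction
    case (step n m x)
    then show ?case
      using tensor_eq.step[of "k \<otimes>\<^bsub>N\<^esub> n" N m A x f] assms(5) monoid_hom_closed[OF assms(4)]
      by (simp add: N.m_assoc)
  qed (use assms(5) in \<open>auto intro: tensor_eq.intros\<close>)
qed

text \<open>The arrow \<open>(f, f0)\<close> exhibits \<open>B\<close> as the tensor product \<open>mon B \<otimes> A\<close> over \<open>mon A\<close>. The
  converse of the second clause holds for every arrow, since \<open>f0\<close> is equivariant.\<close>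

definition tensorial :: "('u \<Rightarrow> 'u) \<Rightarrow> ('u \<Rightarrow> 'u) \<Rightarrow> 'u lmset \<Rightarrow> 'u lmset \<Rightarrow> bool" where
  "tensorial f f0 A B \<longleftrightarrow>
    (\<forall>y\<in>pts B. \<exists>n\<in>carrier (mon B). \<exists>x\<in>pts A. y = act B (n, f0 x)) \<and>
    (\<forall>n\<in>carrier (mon B). \<forall>x\<in>pts A. \<forall>n'\<in>carrier (mon B). \<forall>x'\<in>pts A.
      act B (n, f0 x) = act B (n', f0 x') \<longrightarrow> tensor_eq (mon B) f A n x n' x')"

text \<open>Universal property at the level of sets. Each \<open>y\<close> has a presentation
  \<open>act B (n, f0 x)\<close>; two presentations of it are related by the kernel clause, so the
  balanced \<open>F\<close> takes the same value on both. Choice then assembles these values into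
  \<open>w\<close>.\<close>

lemma tensorial_extend:
  assumes "tensorial f f0 A B"
    and "\<And>n x. n \<in> carrier (mon B) \<Longrightarrow> x \<in> pts A \<Longrightarrow> act B (n, f0 x) \<in> pts B"
    and closed: "\<And>n x. n \<in> carrier (mon B) \<Longrightarrow> x \<in> pts A \<Longrightarrow> F n x \<in> Z"
    and "\<And>n m x. n \<in> carrier (mon B) \<Longrightarrow> m \<in> carrier (mon A) \<Longrightarrow> x \<in> pts A
      \<Longrightarrow> F (n \<otimes>\<^bsub>mon B\<^esub> f m) x = F n (act A (m, x))"
  obtains w where "w \<in> pts B \<rightarrow> Z"
    and "\<And>n x. n \<in> carrier (mon B) \<Longrightarrow> x \<in> pts A \<Longrightarrow> w (act B (n, f0 x)) = F n x"
proof -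
  have "\<exists>z\<in>Z. \<forall>n\<in>carrier (mon B). \<forall>x\<in>pts A. y = act B (n, f0 x) \<longrightarrow> z = F n x"
    if y: "y \<in> pts B" for y
  proof -
    obtain n x where n: "n \<in> carrier (mon B)" "x \<in> pts A" "y = act B (n, f0 x)"
      using assms(1) y unfolding tensorial_def by blast
    show ?thesis
    proof (intro bexI[of _ "F n x"] ballI impI)
      fix n' x' assume "n' \<in> carrier (mon B)" "x' \<in> pts A" "y = act B (n', f0 x')"
      then have "tensor_eq (mon B) f A n x n' x'"
        using n assms(1) unfolding tensorial_def by metis
      then show "F n x = F n' x'"
        by (rule tensor_eq_balanced) (rule assms(4))
    qed (use n closed in auto)
  qed
  then obtain w where w: "\<And>y. y \<in> pts B \<Longrightarrow> w y \<in> Z \<and>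
      (\<forall>n\<in>carrier (mon B). \<forall>x\<in>pts A. y = act B (n, f0 x) \<longrightarrow> w y = F n x)"
    by metis
  show ?thesis
    using that[of w] w assms(2) by blast
qed

text \<open>A factorisation over \<open>g\<close> is determined on the elements
  \<open>act B (n, f0 x)\<close>, which exhaust \<open>B\<close>, and it exists because the forced
  values are balanced.\<close>

lemma tensorial_imp_cocartesian:
  assumes u: "Arrow A (f, f0) B \<in> Hom (LMSet U) A B" and t: "tensorial f f0 A B"
  shows "cocartesian (LMSet U) (Mon U) V (Arrow A (f, f0) B)"
  unfolding cocartesian_def
proof (intro conjI ballI impI)
  show "Arrow A (f, f0) B \<in> Arr (LMSet U)"
    using u by (simp add: Hom_def)
next
  fix C v g
  assume v: "v \<in> Hom (LMSet U) (Dom (LMSet U) (Arrow A (f, f0) B)) C"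
    and g: "g \<in> Hom (Mon U) (obj_map V (Cod (LMSet U) (Arrow A (f, f0) B))) (obj_map V C)"
    and eq: "Comp (Mon U) g (arr_map V (Arrow A (f, f0) B)) = arr_map V v"
  obtain h h0 where h: "v = Arrow A (h, h0) C" "C \<in> lmset_objects U" "(h, h0) \<in> lmset_hom A C"
    using v by (auto simp: Hom_LMSet_iff)
  obtain g' where g': "g = Arrow (mon B) g' (mon C)" "g' \<in> monoid_hom (mon B) (mon C)"
    using g by (auto simp: Hom_Mon_iff)
  have u': "A \<in> lmset_objects U" "B \<in> lmset_objects U" "(f, f0) \<in> lmset_hom A B"
    using u by (auto simp: Hom_LMSet_iff)
  note A = lmset_objectsD[OF u'(1)] and B = lmset_objectsD[OF u'(2)] and C = lmset_objectsD[OF h(2)]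
  interpret B: monoid "mon B" by (rule B(2))
  have f: "f m \<in> carrier (mon B)" if "m \<in> carrier (mon A)" for m
    using that u'(3) by (auto simp: lmset_hom_iff monoid_hom_closed)
  have f0: "f0 x \<in> pts B" if "x \<in> pts A" for x
    using that u'(3) by (auto simp: lmset_hom_iff)
  have h0: "h0 x \<in> pts C" if "x \<in> pts A" for x
    using that h(3) by (auto simp: lmset_hom_iff)
  have h0_act: "h0 (act A (m, x)) = act C (h m, h0 x)" if "m \<in> carrier (mon A)" "x \<in> pts A" for m x
    using that h(3) by (auto simp: lmset_hom_iff)
  have gf: "compose (carrier (mon A)) g' f = h"
    using eq h(1) g'(1) by simp
  then have h_eq: "h m = g' (f m)" if "m \<in> carrier (mon A)" for m
    using that by (auto simp: compose_eq)
  have g'_mult: "g' (n \<otimes>\<^bsub>mon B\<^esub> k) = g' n \<otimes>\<^bsub>mon C\<^esub> g' k"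
    if "n \<in> carrier (mon B)" "k \<in> carrier (mon B)" for n k
    using that g'(2) by (simp add: monoid_hom_iff)
  have g'_one: "g' \<one>\<^bsub>mon B\<^esub> = \<one>\<^bsub>mon C\<^esub>"
    using g'(2) by (simp add: monoid_hom_iff)
  note g'c = monoid_hom_closed[OF g'(2)]
  \<comment> \<open>Equivariance over \<open>g'\<close> together with the required composite
    \<open>h0\<close> forces this formula for \<open>w\<close>. It is balanced since
    \<open>h m = g' (f m)\<close> and \<open>h0\<close> is equivariant over
    \<open>h\<close>.\<close>
  obtain w where w: "w \<in> pts B \<rightarrow> pts C"
    and w_act: "\<And>n x. n \<in> carrier (mon B) \<Longrightarrow> x \<in> pts A \<Longrightarrow> w (act B (n, f0 x)) = act C (g' n, h0 x)"
    by (rule tensorial_extend[OF t, of "\<lambda>n x. act C (g' n, h0 x)" "pts C"])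
      (simp_all add: B C f0 h0 h0_act g'c g'_mult f h_eq)
  have gen: "\<exists>n\<in>carrier (mon B). \<exists>x\<in>pts A. y = act B (n, f0 x)" if "y \<in> pts B" for y
    using that t unfolding tensorial_def by blast
  have hom: "(g', restrict w (pts B)) \<in> lmset_hom B C"
    unfolding lmset_hom_iff
  proof (intro conjI ballI)
    fix k y assume k: "k \<in> carrier (mon B)" and y: "y \<in> pts B"
    obtain n x where n: "n \<in> carrier (mon B)" "x \<in> pts A" "y = act B (n, f0 x)"
      using gen[OF y] by blast
    have "w (act B (k, y)) = w (act B (k \<otimes>\<^bsub>mon B\<^esub> n, f0 x))"
      using k n B f0 by simp
    also have "\<dots> = act C (g' k, act C (g' n, h0 x))"
      using w_act[of "k \<otimes>\<^bsub>mon B\<^esub> n" x] k n C h0 g'c g'_mult by simp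
    finally show "restrict w (pts B) (act B (k, y)) = act C (g' k, restrict w (pts B) y)"
      using k y n B w_act by simp
  qed (use g' w in auto)
  \<comment> \<open>The composite is computed by presenting \<open>f0 x\<close> with the unit of
    \<open>mon B\<close> as scalar.\<close>
  have wf: "compose (pts A) (restrict w (pts B)) f0 = h0"
  proof
    fix x show "compose (pts A) (restrict w (pts B)) f0 x = h0 x"
    proof (cases "x \<in> pts A")
      case True
      then show ?thesis
        using w_act[of "\<one>\<^bsub>mon B\<^esub>" x] B C f0 h0 g'_one by (simp add: compose_eq)
    next
      case False
      then show ?thesis
        using lmset_hom_PiE(2)[OF h(3)] by (auto simp: compose_def PiE_def extensional_def)
    qed
  qed
  show "\<exists>!w. w \<in> Hom (LMSet U) (Cod (LMSet U) (Arrow A (f, f0) B)) C \<and> arr_map V w = g \<and>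
      Comp (LMSet U) w (Arrow A (f, f0) B) = v"
  proof
    show "Arrow B (g', restrict w (pts B)) C \<in> Hom (LMSet U) (Cod (LMSet U) (Arrow A (f, f0) B)) C \<and>
      arr_map V (Arrow B (g', restrict w (pts B)) C) = g \<and>
      Comp (LMSet U) (Arrow B (g', restrict w (pts B)) C) (Arrow A (f, f0) B) = v"
      using hom wf gf g' h u' by (simp add: Hom_LMSet_iff)
    fix w' assume w': "w' \<in> Hom (LMSet U) (Cod (LMSet U) (Arrow A (f, f0) B)) C \<and> arr_map V w' = g \<and>
      Comp (LMSet U) w' (Arrow A (f, f0) B) = v"
    then obtain w0 where w0: "w' = Arrow B (g', w0) C" "(g', w0) \<in> lmset_hom B C"
      "compose (pts A) w0 f0 = h0"
      using g' h by (auto simp: Hom_LMSet_iff)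
    have "w0 = restrict w (pts B)"
    proof
      fix y show "w0 y = restrict w (pts B) y"
      proof (cases "y \<in> pts B")
        case True
        then obtain n x where n: "n \<in> carrier (mon B)" "x \<in> pts A" "y = act B (n, f0 x)"
          using gen by blast
        have "w0 (f0 x) = h0 x"
          using w0(3) n(2) by (auto simp: compose_eq)
        moreover have "w0 y = act C (g' n, w0 (f0 x))"
          using w0(2) n f0 by (simp add: lmset_hom_iff)
        ultimately show ?thesis
          using n True w_act by simp
      next
        case False
        then show ?thesis
          using lmset_hom_PiE(2)[OF w0(2)] by (auto simp: PiE_def extensional_def)
      qed
    qed
    then show "w' = Arrow B (g', restrict w (pts B)) C"
      using w0(1) by simp
  qed
qed

section \<open>Characterisation and existence of cocartesian arrows\<close>

lemma cocartesian_ex1: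
  assumes "cocartesian X B P u" "c \<in> Obj X" "v \<in> Hom X (Dom X u) c"
    and "g \<in> Hom B (obj_map P (Cod X u)) (obj_map P c)" "Comp B g (arr_map P u) = arr_map P v"
  shows "\<exists>!w. w \<in> Hom X (Cod X u) c \<and> arr_map P w = g \<and> Comp X w u = v"
  using assms by (simp add: cocartesian_def)

text \<open>The universal property over an identity homomorphism: two arrows out of \<open>A\<close>
  over the same \<open>f\<close> are compared inside the fibre over \<open>mon B\<close>. The monoid
  component is then fixed, so only the map on points is quantified.\<close>

lemma cocartesian_vertical:
  assumes "cocartesian (LMSet U) (Mon U) V (Arrow A (f, f0) B)"
    and C: "Arrow A (f, h0) C \<in> Hom (LMSet U) A C" "mon C = mon B"
  shows "\<exists>!w. (restrict id (carrier (mon B)), w) \<in> lmset_hom B C \<and> compose (pts A) w f0 = h0"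
proof -
  let ?u = "Arrow A (f, f0) B" and ?v = "Arrow A (f, h0) C"
  let ?i = "restrict id (carrier (mon B))"
  have u: "?u \<in> Hom (LMSet U) A B"
    using assms(1) by (simp add: cocartesian_def Hom_def)
  then have B: "B \<in> lmset_objects U" "f \<in> monoid_hom (mon A) (mon B)"
    by (auto simp: Hom_LMSet_iff lmset_hom_iff)
  have C': "C \<in> lmset_objects U"
    using C by (auto simp: Hom_LMSet_iff)
  have if_f: "compose (carrier (mon A)) ?i f = f"
    using restrict_id_compose[OF monoid_hom_PiE[OF B(2)]] .
  have "\<exists>!w. w \<in> Hom (LMSet U) B C \<and> arr_map V w = Arrow (mon B) ?i (mon C) \<and> Comp (LMSet U) w ?u = ?v"
    using cocartesian_ex1[OF assms(1), of C ?v "Arrow (mon B) ?i (mon C)"] C C' if_f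
      lmset_objectsD(1,2)[OF B(1)]
    by (simp add: Hom_Mon_iff monoid_hom_id)
  then obtain w where w: "w \<in> Hom (LMSet U) B C" "arr_map V w = Arrow (mon B) ?i (mon C)"
      "Comp (LMSet U) w ?u = ?v"
    and uniq: "\<And>w'. w' \<in> Hom (LMSet U) B C \<Longrightarrow> arr_map V w' = Arrow (mon B) ?i (mon C)
      \<Longrightarrow> Comp (LMSet U) w' ?u = ?v \<Longrightarrow> w' = w"
    by blast
  show ?thesis
  proof
    show "(?i, snd (fn w)) \<in> lmset_hom B C \<and> compose (pts A) (snd (fn w)) f0 = h0"
      using w by (auto simp: Hom_LMSet_iff)
    fix w0 assume "(?i, w0) \<in> lmset_hom B C \<and> compose (pts A) w0 f0 = h0"
    then have "Arrow B (?i, w0) C = w"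
      using B C' C(2) if_f by (intro uniq) (auto simp: Hom_LMSet_iff)
    then show "w0 = snd (fn w)"
      by auto
  qed
qed

context universe
begin

text \<open>Smallness of the tensor product does not need closure of the universe under quotients:
  classes are represented by chosen elements of the small set \<open>pair_set pr (carrier N) (pts A)\<close>.\<close>

lemma tensorial_lift:
  assumes A: "A \<in> lmset_objects U" and N: "N \<in> monoid_objects U" and f: "f \<in> monoid_hom (mon A) N"
  obtains T l where "mon T = N" "Arrow A (f, l) T \<in> Hom (LMSet U) A T" "tensorial f l A T"
proof -
  interpret N: monoid N using N by (rule monoid_objects_monoid)
  note fc = monoid_hom_closed[OF f]
  note closed = tensor_eq_closed[OF _ N A f]
  define cls where "cls n x = (SOME z. \<exists>n' x'. z = pr n' x' \<and> tensor_eq N f A n x n' x')" for n x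
  have cls: "\<exists>n' x'. cls n x = pr n' x' \<and> tensor_eq N f A n x n' x'"
    if "n \<in> carrier N" "x \<in> pts A" for n x
    unfolding cls_def by (rule someI_ex) (rule exI[of _ "pr n x"], rule exI[of _ n], rule exI[of _ x], simp add: tensor_eq.refl that)
  have cls_eq: "cls n x = cls n' x'" if "tensor_eq N f A n x n' x'" for n x n' x'
  proof -
    \<comment> \<open>Related pairs determine the same predicate, and \<open>SOME\<close> applied to
      equal predicates returns the same representative.\<close>
    have "tensor_eq N f A n x = tensor_eq N f A n' x'"
      using that by (intro ext iffI) (blast intro: tensor_eq.sym tensor_eq.trans)+
    then show ?thesis
      by (simp add: cls_def)
  qed
  have cls_eqD: "tensor_eq N f A n x n' x'"
    if "cls n x = cls n' x'" "n \<in> carrier N" "x \<in> pts A" "n' \<in> carrier N" "x' \<in> pts A" for n x n' x'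
    using cls[of n x] cls[of n' x'] that by (metis pr_inject tensor_eq.sym tensor_eq.trans)
  define Y where "Y = {cls n x | n x. n \<in> carrier N \<and> x \<in> pts A}"
  define \<phi> where "\<phi> = (\<lambda>(k, z)\<in>carrier N \<times> Y. cls (k \<otimes>\<^bsub>N\<^esub> pr_fst pr z) (pr_snd pr z))"
  define l where "l = (\<lambda>x\<in>pts A. cls \<one>\<^bsub>N\<^esub> x)"
  define T where "T = LMSet_obj N Y \<phi>"
  have Y: "cls n x \<in> Y" if "n \<in> carrier N" "x \<in> pts A" for n x
    using that by (auto simp: Y_def)
  \<comment> \<open>The action is defined through the chosen representative; compatibility of
    \<open>tensor_eq\<close> with left multiplication shows that any other pair in the class gives
    the same result.\<close>
  have \<phi>: "\<phi> (k, cls n x) = cls (k \<otimes>\<^bsub>N\<^esub> n) x" if k: "k \<in> carrier N" "n \<in> carrier N" "x \<in> pts A" for k n x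
  proof -
    obtain n' x' where n': "cls n x = pr n' x'" "tensor_eq N f A n x n' x'"
      using cls k by blast
    have "cls (k \<otimes>\<^bsub>N\<^esub> n) x = cls (k \<otimes>\<^bsub>N\<^esub> n') x'"
      by (rule cls_eq) (rule tensor_eq_mult[OF n'(2) N A f k(1)])
    then show ?thesis
      using n' Y[OF k(2,3)] k by (simp add: \<phi>_def)
  qed
  have "Y \<subseteq> pair_set pr (carrier N) (pts A)"
    using cls closed by (fastforce simp: Y_def)
  moreover have "pair_set pr (carrier N) (pts A) \<in> U"
    using A N by (simp add: pair_set_small monoid_objects_small lmset_objects_iff)
  ultimately have small: "Y \<in> U"
    using subset_small by blast
  have "\<phi> \<in> carrier N \<times> Y \<rightarrow>\<^sub>E Y"
  proof (rule PiE_I)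
    fix p assume "p \<in> carrier N \<times> Y"
    then show "\<phi> p \<in> Y"
      using \<phi> Y by (auto simp: Y_def)
  qed (auto simp: \<phi>_def)
  then have "left_action N Y \<phi>"
    by (auto simp: left_action_def Y_def \<phi> N.m_assoc)
  then have T: "T \<in> lmset_objects U"
    using N small by (simp add: T_def lmset_objects_iff)
  \<comment> \<open>The generator with scalar one, read backwards, is exactly the equivariance of
    \<open>l\<close> over \<open>f\<close>.\<close>
  have "cls \<one>\<^bsub>N\<^esub> (act A (m, x)) = cls (f m) x" if "m \<in> carrier (mon A)" "x \<in> pts A" for m x
    using cls_eq[OF tensor_eq.step[of "\<one>\<^bsub>N\<^esub>" N m A x f]] that fc by simp
  then have "(f, l) \<in> lmset_hom A T"
    using f Y fc \<phi> lmset_objectsD[OF A] by (auto simp: lmset_hom_iff T_def l_def)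
  moreover have "tensorial f l A T"
    unfolding tensorial_def by (auto simp: T_def l_def \<phi> Y_def dest!: cls_eqD)
  ultimately show ?thesis
    using that[of T l] A T by (simp add: Hom_LMSet_iff T_def)
qed

text \<open>The given arrow is compared with the tensor product \<open>T\<close> over the same
  homomorphism. Vertical maps \<open>w\<close> into \<open>T\<close> and \<open>w'\<close> back to
  \<open>B\<close> exist by cocartesianness of the two arrows; the presentation of elements is
  pulled back along \<open>w'\<close> and the kernel condition along \<open>w\<close>.\<close>

lemma cocartesian_imp_tensorial:
  assumes co: "cocartesian (LMSet U) (Mon U) V (Arrow A (f, f0) B)"
  shows "tensorial f f0 A B"
proof -
  have u: "Arrow A (f, f0) B \<in> Hom (LMSet U) A B"
    using co by (simp add: cocartesian_def Hom_def)
  then have AB: "A \<in> lmset_objects U" "B \<in> lmset_objects U" "(f, f0) \<in> lmset_hom A B"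
    by (auto simp: Hom_LMSet_iff)
  then have f: "f \<in> monoid_hom (mon A) (mon B)" and f0: "f0 \<in> pts A \<rightarrow>\<^sub>E pts B"
    by (auto simp: lmset_hom_iff)
  obtain T l where T: "mon T = mon B" and l: "Arrow A (f, l) T \<in> Hom (LMSet U) A T"
    and t: "tensorial f l A T"
    using tensorial_lift[OF AB(1) lmset_objectsD(1)[OF AB(2)] f] by blast
  let ?i = "restrict id (carrier (mon B))"
  obtain w where w: "(?i, w) \<in> lmset_hom B T" "compose (pts A) w f0 = l"
    using cocartesian_vertical[OF co l T] by blast
  obtain w' where w': "(?i, w') \<in> lmset_hom T B" "compose (pts A) w' l = f0"
    using cocartesian_vertical[OF tensorial_imp_cocartesian[OF l t] u] T by auto
  have wf: "w (f0 x) = l x" and w'l: "w' (l x) = f0 x" if "x \<in> pts A" for x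
    using that compose_eq[of x "pts A" w f0] compose_eq[of x "pts A" w' l] w(2) w'(2) by simp_all
  have wc: "w y \<in> pts T" if "y \<in> pts B" for y
    using that w(1) by (auto simp: lmset_hom_iff)
  have ii: "compose (carrier (mon B)) ?i ?i = ?i"
    by (auto simp: compose_def)
  have "(?i, compose (pts B) w' w) \<in> lmset_hom B B"
    using lmset_hom_compose[OF AB(2) w(1) w'(1)] ii by simp
  moreover have "compose (pts A) (compose (pts B) w' w) f0 = f0"
    using compose_compose[OF f0, of w' w] w(2) w'(2) by simp
  moreover have "(?i, restrict id (pts B)) \<in> lmset_hom B B"
    using lmset_objectsD[OF AB(2)] by (auto simp: lmset_hom_iff monoid_hom_id)
  moreover have "compose (pts A) (restrict id (pts B)) f0 = f0"
    using restrict_id_compose[OF f0] .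
  \<comment> \<open>Both this composite and the identity are vertical endomorphisms of
    \<open>B\<close> that fix \<open>f0\<close>, so uniqueness makes them equal.\<close>
  ultimately have "compose (pts B) w' w = restrict id (pts B)"
    using cocartesian_vertical[OF co u] by blast
  then have w'w: "w' (w y) = y" if "y \<in> pts B" for y
    using that by (metis compose_eq restrict_apply' id_apply)
  show ?thesis
    unfolding tensorial_def
  proof (intro conjI ballI impI)
    fix y assume y: "y \<in> pts B"
    then obtain n x where n: "n \<in> carrier (mon B)" "x \<in> pts A" "w y = act T (n, l x)"
      using t wc T unfolding tensorial_def by metis
    have "l x \<in> pts T"
      using l n by (auto simp: Hom_LMSet_iff lmset_hom_iff)
    \<comment> \<open>Apply \<open>w'\<close> to the presentation of \<open>w y\<close> in
      \<open>T\<close>.\<close>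
    then have "y = act B (n, f0 x)"
      using w'(1) w'l n T w'w[OF y] by (auto simp: lmset_hom_iff)
    with n show "\<exists>n\<in>carrier (mon B). \<exists>x\<in>pts A. y = act B (n, f0 x)"
      by blast
  next
    fix n x n' x'
    assume n: "n \<in> carrier (mon B)" "x \<in> pts A" "n' \<in> carrier (mon B)" "x' \<in> pts A"
      and eq: "act B (n, f0 x) = act B (n', f0 x')"
    have *: "w (act B (k, f0 y)) = act T (k, l y)" if "k \<in> carrier (mon B)" "y \<in> pts A" for k y
      using w(1) that PiE_mem[OF f0 that(2)] wf by (simp add: lmset_hom_iff)
    have "act T (n, l x) = act T (n', l x')"
      using *[OF n(1,2)] *[OF n(3,4)] eq by simp
    then show "tensor_eq (mon B) f A n x n' x'"
      using t n T unfolding tensorial_def by metis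
  qed
qed

text \<open>The product arrow is known only through its projection equations. Evaluating them at a
  pair yields both coordinates of the image, which is itself a pair because \<open>k\<close> and
  \<open>k0\<close> map into pair sets.\<close>

lemma prod_arr_LMSet:
  assumes u: "Arrow A (f, f0) B \<in> Hom (LMSet U) A B" and v: "Arrow C (g, g0) D \<in> Hom (LMSet U) C D"
  obtains k k0 where "prod_arr (LMSet U) (LMSet_products pr pt) (Arrow A (f, f0) B) (Arrow C (g, g0) D) =
      Arrow (prod_lmset pr A C) (k, k0) (prod_lmset pr B D)"
    and "prod_arr (LMSet U) (LMSet_products pr pt) (Arrow A (f, f0) B) (Arrow C (g, g0) D)
      \<in> Hom (LMSet U) (prod_lmset pr A C) (prod_lmset pr B D)"
    and "\<And>m n. m \<in> carrier (mon A) \<Longrightarrow> n \<in> carrier (mon C) \<Longrightarrow> k (pr m n) = pr (f m) (g n)"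
    and "\<And>x y. x \<in> pts A \<Longrightarrow> y \<in> pts C \<Longrightarrow> k0 (pr x y) = pr (f0 x) (g0 y)"
proof -
  interpret cartesian_category "LMSet U" "LMSet_products pr pt" by (rule cartesian_LMSet)
  let ?w = "prod_arr (LMSet U) (LMSet_products pr pt) (Arrow A (f, f0) B) (Arrow C (g, g0) D)"
  note w = prod_arr_props[OF u v, simplified]
  obtain k k0 where k: "?w = Arrow (prod_lmset pr A C) (k, k0) (prod_lmset pr B D)"
    "(k, k0) \<in> lmset_hom (prod_lmset pr A C) (prod_lmset pr B D)"
    using w(1) by (auto simp: Hom_LMSet_iff)
  note kc = lmset_hom_PiE[OF k(2), simplified]
  note eqs = w(2,3)[unfolded k(1), simplified]
  have "k (pr m n) = pr (f m) (g n)" if mn: "m \<in> carrier (mon A)" "n \<in> carrier (mon C)" for m n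
  proof -
    let ?Z = "pair_set pr (carrier (mon A)) (carrier (mon C))"
    let ?W = "pair_set pr (carrier (mon B)) (carrier (mon D))"
    have "compose ?Z (restrict (pr_fst pr) ?W) k (pr m n) = compose ?Z f (restrict (pr_fst pr) ?Z) (pr m n)"
      "compose ?Z (restrict (pr_snd pr) ?W) k (pr m n) = compose ?Z g (restrict (pr_snd pr) ?Z) (pr m n)"
      using eqs by simp_all
    moreover have "k (pr m n) \<in> ?W"
      using kc(1) mn by auto
    ultimately show ?thesis
      using mn by (auto simp: compose_eq elim!: pair_setE)
  qed
  moreover have "k0 (pr m n) = pr (f0 m) (g0 n)" if mn: "m \<in> pts A" "n \<in> pts C" for m n
  proof -
    let ?Z = "pair_set pr (pts A) (pts C)"
    let ?W = "pair_set pr (pts B) (pts D)"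
    have "compose ?Z (restrict (pr_fst pr) ?W) k0 (pr m n) = compose ?Z f0 (restrict (pr_fst pr) ?Z) (pr m n)"
      "compose ?Z (restrict (pr_snd pr) ?W) k0 (pr m n) = compose ?Z g0 (restrict (pr_snd pr) ?Z) (pr m n)"
      using eqs by simp_all
    moreover have "k0 (pr m n) \<in> ?W"
      using kc(2) mn by auto
    ultimately show ?thesis
      using mn by (auto simp: compose_eq elim!: pair_setE)
  qed
  ultimately show ?thesis
    using that[OF k(1) w(1)] by blast
qed

text \<open>Presentations of the two coordinates combine into one of the pair. Equality of pairs
  splits into two coordinate equalities, each giving a \<open>tensor_eq\<close>; these are lifted to
  the product separately and then joined by transitivity.\<close>

lemma tensorial_prod:
  assumes u: "Arrow A (f, f0) B \<in> Hom (LMSet U) A B" and v: "Arrow C (g, g0) D \<in> Hom (LMSet U) C D"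
    and tu: "tensorial f f0 A B" and tv: "tensorial g g0 C D"
    and k: "\<And>m n. m \<in> carrier (mon A) \<Longrightarrow> n \<in> carrier (mon C) \<Longrightarrow> k (pr m n) = pr (f m) (g n)"
    and k0: "\<And>x y. x \<in> pts A \<Longrightarrow> y \<in> pts C \<Longrightarrow> k0 (pr x y) = pr (f0 x) (g0 y)"
  shows "tensorial k k0 (prod_lmset pr A C) (prod_lmset pr B D)"
proof -
  have ob: "A \<in> lmset_objects U" "B \<in> lmset_objects U" "C \<in> lmset_objects U" "D \<in> lmset_objects U"
    and hom: "(f, f0) \<in> lmset_hom A B" "(g, g0) \<in> lmset_hom C D"
    using u v by (simp_all add: Hom_LMSet_iff)
  note A = lmset_objectsD[OF ob(1)] and B = lmset_objectsD[OF ob(2)]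
    and C = lmset_objectsD[OF ob(3)] and D = lmset_objectsD[OF ob(4)]
  interpret A: monoid "mon A" by (rule A(2))
  interpret B: monoid "mon B" by (rule B(2))
  interpret C: monoid "mon C" by (rule C(2))
  interpret D: monoid "mon D" by (rule D(2))
  have f: "f \<in> monoid_hom (mon A) (mon B)" and g: "g \<in> monoid_hom (mon C) (mon D)"
    and f0: "\<And>x. x \<in> pts A \<Longrightarrow> f0 x \<in> pts B" and g0: "\<And>x. x \<in> pts C \<Longrightarrow> g0 x \<in> pts D"
    using hom by (auto simp: lmset_hom_iff)
  have one: "f \<one>\<^bsub>mon A\<^esub> = \<one>\<^bsub>mon B\<^esub>" "g \<one>\<^bsub>mon C\<^esub> = \<one>\<^bsub>mon D\<^esub>"
    using f g by (auto simp: monoid_hom_iff)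
  let ?eq = "tensor_eq (mon (prod_lmset pr B D)) k (prod_lmset pr A C)"
  note closed1 = tensor_eq_closed[OF _ B(1) ob(1) f] and closed2 = tensor_eq_closed[OF _ D(1) ob(3) g]
  \<comment> \<open>A generator for \<open>m\<close> in the first coordinate becomes the product
    generator for \<open>pr m \<one>\<close>: since \<open>g\<close> preserves the unit,
    \<open>p\<close> is unchanged, and the unit acts trivially on \<open>y\<close>.\<close>
  have left: "?eq (pr n p) (pr x y) (pr n' p) (pr x' y)"
    if "tensor_eq (mon B) f A n x n' x'" "p \<in> carrier (mon D)" "y \<in> pts C" for n x n' x' p y
    using that(1)
  proof induction
    case (refl n x)
    with that(2,3) show ?case by (auto intro: tensor_eq.refl)
  next
    case (step n m x)
    with that(2,3) show ?case
      using tensor_eq.step[of "pr n p" "mon (prod_lmset pr B D)" "pr m \<one>\<^bsub>mon C\<^esub>" "prod_lmset pr A C" "pr x y" k]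
      by (simp add: k one C monoid_hom_closed[OF f])
  qed (blast intro: tensor_eq.sym tensor_eq.trans)+
  have right: "?eq (pr n p) (pr x y) (pr n p') (pr x y')"
    if "tensor_eq (mon D) g C p y p' y'" "n \<in> carrier (mon B)" "x \<in> pts A" for p y p' y' n x
    using that(1)
  proof induction
    case (refl p y)
    with that(2,3) show ?case by (auto intro: tensor_eq.refl)
  next
    case (step p m y)
    with that(2,3) show ?case
      using tensor_eq.step[of "pr n p" "mon (prod_lmset pr B D)" "pr \<one>\<^bsub>mon A\<^esub> m" "prod_lmset pr A C" "pr x y" k]
      by (simp add: k one A monoid_hom_closed[OF g])
  qed (blast intro: tensor_eq.sym tensor_eq.trans)+
  \<comment> \<open>The first coordinate moves while the second stays at \<open>p\<close>,
    \<open>y\<close>; then the second moves while the first stays at \<open>n'\<close>,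
    \<open>x'\<close>. Closedness puts these fixed values in the right sets.\<close>
  have both: "?eq (pr n p) (pr x y) (pr n' p') (pr x' y')"
    if "tensor_eq (mon B) f A n x n' x'" "tensor_eq (mon D) g C p y p' y'" for n x n' x' p y p' y'
    using left[OF that(1) closed2(1,2)[OF that(2)]] right[OF that(2) closed1(3,4)[OF that(1)]]
    by (rule tensor_eq.trans)
  show ?thesis
    unfolding tensorial_def
  proof (intro conjI ballI impI)
    fix z assume "z \<in> pts (prod_lmset pr B D)"
    then obtain b d where z: "z = pr b d" "b \<in> pts B" "d \<in> pts D"
      by (auto elim: pair_setE)
    obtain n x where n: "n \<in> carrier (mon B)" "x \<in> pts A" "b = act B (n, f0 x)"
      using z tu unfolding tensorial_def by blast
    obtain p y where p: "p \<in> carrier (mon D)" "y \<in> pts C" "d = act D (p, g0 y)"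
      using z tv unfolding tensorial_def by blast
    show "\<exists>n\<in>carrier (mon (prod_lmset pr B D)). \<exists>x\<in>pts (prod_lmset pr A C).
        z = act (prod_lmset pr B D) (n, k0 x)"
      using n p z f0 g0 by (intro bexI[of _ "pr n p"] bexI[of _ "pr x y"]) (simp_all add: k0)
  next
    fix r s r' s'
    assume "r \<in> carrier (mon (prod_lmset pr B D))" "s \<in> pts (prod_lmset pr A C)"
      "r' \<in> carrier (mon (prod_lmset pr B D))" "s' \<in> pts (prod_lmset pr A C)"
      and eq: "act (prod_lmset pr B D) (r, k0 s) = act (prod_lmset pr B D) (r', k0 s')"
    then obtain n p x y n' p' x' y' where r: "r = pr n p" "s = pr x y" "r' = pr n' p'" "s' = pr x' y'"
      and c: "n \<in> carrier (mon B)" "p \<in> carrier (mon D)" "x \<in> pts A" "y \<in> pts C"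
        "n' \<in> carrier (mon B)" "p' \<in> carrier (mon D)" "x' \<in> pts A" "y' \<in> pts C"
      by (auto elim!: pair_setE)
    have "act B (n, f0 x) = act B (n', f0 x')" "act D (p, g0 y) = act D (p', g0 y')"
      using eq c f0 g0 by (simp_all add: r k0 pr_inject)
    then show "?eq r s r' s'"
      unfolding r using c tu tv by (intro both) (simp_all add: tensorial_def)
  qed
qed

end

text \<open>Lifts are the tensor products, which are cocartesian because tensorial. For products,
  cocartesian factors are turned into tensorial ones, multiplied there, and turned back.\<close>

theorem proposition6p2:
  fixes U :: "'u set set" and pr :: "'u \<Rightarrow> 'u \<Rightarrow> 'u" and pt :: 'u
  assumes "universe U pr pt"
  shows "cartesian_monoidal_opfibration
    (LMSet U) (LMSet_products pr pt) (Mon U) (Mon_products pr pt) V"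
proof -
  interpret universe U pr pt by fact
  interpret V: strict_cartesian_functor "LMSet U" "LMSet_products pr pt" "Mon U" "Mon_products pr pt" V
    by (rule strict_cartesian_V)
  show ?thesis
  \<comment> \<open>The interpretation \<open>V\<close> discharges the strictness assumptions, which
    leaves the existence of lifts and the closure under products.\<close>
  proof unfold_locales
    fix A f assume A: "A \<in> Obj (LMSet U)" and "f \<in> Arr (Mon U)" "Dom (Mon U) f = obj_map V A"
    then obtain N f' where N: "f = Arrow (mon A) f' N" "N \<in> monoid_objects U" "f' \<in> monoid_hom (mon A) N"
      by (auto simp: Mon_def)
    with A obtain T l where T: "mon T = N" "Arrow A (f', l) T \<in> Hom (LMSet U) A T" "tensorial f' l A T"
      by (auto elim: tensorial_lift)
    then show "\<exists>u. Dom (LMSet U) u = A \<and> arr_map V u = f \<and> cocartesian (LMSet U) (Mon U) V u"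
      using N tensorial_imp_cocartesian[OF T(2,3)] by (intro exI[of _ "Arrow A (f', l) T"]) simp
  next
    fix u v assume co: "cocartesian (LMSet U) (Mon U) V u" "cocartesian (LMSet U) (Mon U) V v"
    then have "u \<in> Arr (LMSet U)" "v \<in> Arr (LMSet U)"
      by (simp_all add: cocartesian_def)
    then obtain A f f0 B C g g0 D where u: "u = Arrow A (f, f0) B" "u \<in> Hom (LMSet U) A B"
      and v: "v = Arrow C (g, g0) D" "v \<in> Hom (LMSet U) C D"
      by (auto simp: LMSet_def Hom_def)
    show "cocartesian (LMSet U) (Mon U) V (prod_arr (LMSet U) (LMSet_products pr pt) u v)"
    proof -
      obtain k k0 where k: "prod_arr (LMSet U) (LMSet_products pr pt) u v =
          Arrow (prod_lmset pr A C) (k, k0) (prod_lmset pr B D)"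
        and hom: "prod_arr (LMSet U) (LMSet_products pr pt) u v
          \<in> Hom (LMSet U) (prod_lmset pr A C) (prod_lmset pr B D)"
        and k_pr: "\<And>m n. m \<in> carrier (mon A) \<Longrightarrow> n \<in> carrier (mon C) \<Longrightarrow> k (pr m n) = pr (f m) (g n)"
        and k0_pr: "\<And>x y. x \<in> pts A \<Longrightarrow> y \<in> pts C \<Longrightarrow> k0 (pr x y) = pr (f0 x) (g0 y)"
        using prod_arr_LMSet[OF u(2)[unfolded u(1)] v(2)[unfolded v(1)]] unfolding u(1) v(1) by blast
      have "tensorial f f0 A B" "tensorial g g0 C D"
        using co u(1) v(1) cocartesian_imp_tensorial by simp_all
      then have "tensorial k k0 (prod_lmset pr A C) (prod_lmset pr B D)"
        using tensorial_prod[OF u(2)[unfolded u(1)] v(2)[unfolded v(1)] _ _ k_pr k0_pr] by blast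
      then show ?thesis
        using tensorial_imp_cocartesian hom k by simp
    qed
  qed
qed

end
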